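(* Let $G_2=\langle x,y \,\|\, xy^{-1}x^{-1}yx=y^{-2}xyx^{-1}y^{-1}xy^{2}\rangle$. Then: 1) The quotient group $\gamma_2G_2/\gamma_3G_2$ is isomorphic to the cyclic group of order 4. 2) For every integer $k\ge 2$, the quotient group $\gamma_kG_2/\gamma_{k+1}G_2$ is a finite group of exponent 4. 3) Modulo $\gamma_4G_2$ the defining relation of $G_2$ has the form $[y,x]^4=[x,y,y]^2$; that is, $G_2/\gamma_4G_2$ is the quotient of $F_2/\gamma_4F_2$, where $F_2=\langle x,y\rangle$ is free on $x,y$, by the single additional relation $[y,x]^4=[x,y,y]^2$.
   Context: $\langle X\,\|\,R\rangle$ denotes the group with generators $X$ and defining relations $R$. $[a,b]=a^{-1}b^{-1}ab$ and $[a,b,c]=[[a,b],c]$. $\gamma_1G=G$ and $\gamma_{k+1}G=[\gamma_kG,G]$ are the terms of the lower central series of a group $G$. *)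

theory Defs
  imports "HOL-Algebra.Algebra"
begin

section \<open>Commutators, the lower central series, exponent\<close>

definition commutator :: "('a, 'b) monoid_scheme \<Rightarrow> 'a \<Rightarrow> 'a \<Rightarrow> 'a" where
  "commutator G a b = inv\<^bsub>G\<^esub> a \<otimes>\<^bsub>G\<^esub> inv\<^bsub>G\<^esub> b \<otimes>\<^bsub>G\<^esub> a \<otimes>\<^bsub>G\<^esub> b"

text \<open>The series is indexed from 1; the value at 0 is a convention that is never used.\<close>

fun lower_central :: "nat \<Rightarrow> ('a, 'b) monoid_scheme \<Rightarrow> 'a set" where
  "lower_central 0 G = carrier G"
| "lower_central (Suc 0) G = carrier G"
| "lower_central (Suc (Suc k)) G =
     generate G {commutator G a b | a b. a \<in> lower_central (Suc k) G \<and> b \<in> carrier G}"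

definition lower_central_factor :: "nat \<Rightarrow> ('a, 'b) monoid_scheme \<Rightarrow> 'a set monoid" where
  "lower_central_factor k G =
     (G\<lparr>carrier := lower_central k G\<rparr>) Mod (lower_central (Suc k) G)"

text \<open>The exponent is the least positive \<open>n\<close> with \<open>x ^ n = 1\<close> for all \<open>x\<close>,
  and 0 if there is no such \<open>n\<close>.\<close>

definition group_exponent :: "('a, 'b) monoid_scheme \<Rightarrow> nat" where
  "group_exponent G =
     (if \<exists>n::nat. n > 0 \<and> (\<forall>x\<in>carrier G. x [^]\<^bsub>G\<^esub> n = \<one>\<^bsub>G\<^esub>)
      then LEAST n::nat. n > 0 \<and> (\<forall>x\<in>carrier G. x [^]\<^bsub>G\<^esub> n = \<one>\<^bsub>G\<^esub>)
      else 0)"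


section \<open>Imposing relations on a group\<close>

definition normal_closure :: "('a, 'b) monoid_scheme \<Rightarrow> 'a set \<Rightarrow> 'a set" where
  "normal_closure G S = \<Inter> {N. N \<lhd> G \<and> S \<subseteq> N}"

text \<open>A pair \<open>(u, v)\<close> stands for the relation \<open>u = v\<close>.\<close>

definition relators :: "('a, 'b) monoid_scheme \<Rightarrow> ('a \<times> 'a) set \<Rightarrow> 'a set" where
  "relators G R = {u \<otimes>\<^bsub>G\<^esub> inv\<^bsub>G\<^esub> v | u v. (u, v) \<in> R}"

definition impose :: "('a, 'b) monoid_scheme \<Rightarrow> ('a \<times> 'a) set \<Rightarrow> 'a set monoid" where
  "impose G R = G Mod normal_closure G (relators G R)"

definition impose_class :: "('a, 'b) monoid_scheme \<Rightarrow> ('a \<times> 'a) set \<Rightarrow> 'a \<Rightarrow> 'a set" where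
  "impose_class G R a = normal_closure G (relators G R) #>\<^bsub>G\<^esub> a"


section \<open>Free groups\<close>

text \<open>A letter \<open>(a, True)\<close> stands for the generator \<open>a\<close>, and \<open>(a, False)\<close> for its inverse.
  Elements of the free group are the freely reduced words.\<close>

type_synonym 'a letter = "'a \<times> bool"

definition flip :: "'a letter \<Rightarrow> 'a letter" where
  "flip p = (fst p, \<not> snd p)"

fun reduced :: "'a letter list \<Rightarrow> bool" where
  "reduced [] = True"
| "reduced [p] = True"
| "reduced (p # q # w) = (q \<noteq> flip p \<and> reduced (q # w))"

text \<open>Left multiplication of a reduced word by a letter.\<close>

fun lmult :: "'a letter \<Rightarrow> 'a letter list \<Rightarrow> 'a letter list" where
  "lmult p [] = [p]"
| "lmult p (q # w) = (if q = flip p then w else p # q # w)"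

definition free_group :: "'a set \<Rightarrow> 'a letter list monoid" where
  "free_group A =
     \<lparr>carrier = {w \<in> lists (A \<times> UNIV). reduced w},
      monoid.mult = (\<lambda>u v. foldr lmult u v),
      one = []\<rparr>"

definition free_gen :: "'a \<Rightarrow> 'a letter list" where
  "free_gen a = [(a, True)]"

lemma flip_flip [simp]: "flip (flip p) = p"
  by (simp add: flip_def)

lemma flip_neq [simp]: "flip p \<noteq> p" "p \<noteq> flip p"
  by (auto simp: flip_def prod_eq_iff)

lemma flip_in [simp]: "flip p \<in> A \<times> UNIV \<longleftrightarrow> p \<in> A \<times> UNIV"
  by (auto simp: flip_def mem_Times_iff)

lemma reduced_tl: "reduced (p # w) \<Longrightarrow> reduced w"
  by (cases w) auto

lemma reduced_lmult: "reduced w \<Longrightarrow> reduced (lmult p w)"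
  by (cases w) (auto dest: reduced_tl)

lemma lmult_reduced: "reduced (p # w) \<Longrightarrow> lmult p w = p # w"
  by (cases w) auto

lemma lmult_lmult_flip: "reduced w \<Longrightarrow> lmult p (lmult (flip p) w) = w"
  by (cases w) (auto simp: lmult_reduced)

lemma reduced_foldr: "reduced w \<Longrightarrow> reduced (foldr lmult u w)"
  by (induction u) (auto intro: reduced_lmult)

lemma foldr_lmult:
  assumes "reduced w"
  shows "foldr lmult (lmult p v) w = lmult p (foldr lmult v w)"
proof (cases v)
  case (Cons q v')
  have "reduced (foldr lmult v' w)"
    using assms by (rule reduced_foldr)
  then show ?thesis
    using Cons by (auto simp: lmult_lmult_flip)
qed simp

lemma foldr_lmult_assoc:
  "reduced w \<Longrightarrow> foldr lmult (foldr lmult u v) w = foldr lmult u (foldr lmult v w)"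
  by (induction u) (auto simp: foldr_lmult)

lemma lmult_lists: "p \<in> A \<times> UNIV \<Longrightarrow> w \<in> lists (A \<times> UNIV) \<Longrightarrow> lmult p w \<in> lists (A \<times> UNIV)"
  by (cases w) auto

lemma foldr_lmult_lists:
  "u \<in> lists (A \<times> UNIV) \<Longrightarrow> w \<in> lists (A \<times> UNIV) \<Longrightarrow> foldr lmult u w \<in> lists (A \<times> UNIV)"
proof (induction u)
  case (Cons p u)
  then show ?case
    using lmult_lists[of p A "foldr lmult u w"] by simp
qed simp

lemma foldr_lmult_Nil: "reduced w \<Longrightarrow> foldr lmult w [] = w"
proof (induction w)
  case (Cons p w)
  then show ?case
    using lmult_reduced[OF Cons.prems] by (simp add: reduced_tl[OF Cons.prems])
qed simp

lemma foldr_lmult_inverse: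
  "reduced w \<Longrightarrow> foldr lmult (map flip (rev u)) (foldr lmult u w) = w"
proof (induction u arbitrary: w)
  case (Cons p u)
  have "lmult (flip p) (lmult p (foldr lmult u w)) = foldr lmult u w"
    using lmult_lmult_flip[of "foldr lmult u w" "flip p"] Cons.prems
    by (simp add: reduced_foldr)
  then show ?case
    using Cons by simp
qed simp

theorem group_free_group: "group (free_group A)"
proof (rule groupI)
  fix u assume u: "u \<in> carrier (free_group A)"
  let ?v = "foldr lmult (map flip (rev u)) []"
  have "map flip (rev u) \<in> lists (A \<times> UNIV)"
    using u by (auto simp: free_group_def in_lists_conv_set flip_def)
  then have "?v \<in> carrier (free_group A)"
    using foldr_lmult_lists[of "map flip (rev u)" A "[]"]
    by (simp add: free_group_def reduced_foldr)
  moreover have "foldr lmult ?v u = []"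
  proof -
    have "foldr lmult ?v u = foldr lmult (map flip (rev u)) u"
      using u by (simp add: foldr_lmult_assoc free_group_def)
    also have "\<dots> = foldr lmult (map flip (rev u)) (foldr lmult u [])"
      using u by (simp add: foldr_lmult_Nil free_group_def)
    finally show ?thesis
      by (simp only: foldr_lmult_inverse reduced.simps)
  qed
  ultimately show "\<exists>v\<in>carrier (free_group A). v \<otimes>\<^bsub>free_group A\<^esub> u = \<one>\<^bsub>free_group A\<^esub>"
    by (auto simp: free_group_def)
qed (auto simp: free_group_def foldr_lmult_lists reduced_foldr foldr_lmult_assoc)


section \<open>The group \<open>G\<^sub>2\<close>\<close>

datatype gens = GX | GY

definition F2 :: "gens letter list monoid" where
  "F2 = free_group UNIV"

definition x_F2 :: "gens letter list" where "x_F2 = free_gen GX"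
definition y_F2 :: "gens letter list" where "y_F2 = free_gen GY"

definition G2_relation :: "(gens letter list \<times> gens letter list) set" where
  "G2_relation =
     (let x = x_F2; y = y_F2; x' = inv\<^bsub>F2\<^esub> x; y' = inv\<^bsub>F2\<^esub> y
      in {(x \<otimes>\<^bsub>F2\<^esub> y' \<otimes>\<^bsub>F2\<^esub> x' \<otimes>\<^bsub>F2\<^esub> y \<otimes>\<^bsub>F2\<^esub> x,
           y' [^]\<^bsub>F2\<^esub> (2::nat) \<otimes>\<^bsub>F2\<^esub> x \<otimes>\<^bsub>F2\<^esub> y \<otimes>\<^bsub>F2\<^esub> x' \<otimes>\<^bsub>F2\<^esub> y'
             \<otimes>\<^bsub>F2\<^esub> x \<otimes>\<^bsub>F2\<^esub> y [^]\<^bsub>F2\<^esub> (2::nat))})"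

definition G2 :: "gens letter list set monoid" where
  "G2 = impose F2 G2_relation"

definition x_G2 :: "gens letter list set" where "x_G2 = impose_class F2 G2_relation x_F2"
definition y_G2 :: "gens letter list set" where "y_G2 = impose_class F2 G2_relation y_F2"

text \<open>The relation \<open>[y, x]^4 = [x, y, y]^2\<close> between two elements of a group.\<close>

definition class3_relation :: "('a, 'b) monoid_scheme \<Rightarrow> 'a \<Rightarrow> 'a \<Rightarrow> ('a \<times> 'a) set" where
  "class3_relation G x y =
     {(commutator G y x [^]\<^bsub>G\<^esub> (4::nat),
       commutator G (commutator G x y) y [^]\<^bsub>G\<^esub> (2::nat))}"

end

theory Submission
  imports Defs "HOL-Computational_Algebra.Formal_Power_Series"
begin

text \<open>
  Write \<open>d = [x, y]\<close>, \<open>c = d\<^sup>-\<^sup>1 = [y, x]\<close> and \<open>e = [x, y, y]\<close>. The relation says that \<open>x c\<close> is the conjugate of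
  \<open>x [y\<^sup>-\<^sup>1, x]\<close> by \<open>y\<^sup>2\<close>, and as soon as \<open>e\<close> is central this conjugate is \<open>x d\<^sup>3 e\<^sup>2\<close>; so modulo
  \<open>\<gamma>\<^sub>4\<close> the relator is a conjugate of \<open>c\<^sup>4 e\<^sup>-\<^sup>2\<close>, and modulo \<open>\<gamma>\<^sub>3\<close> of \<open>c\<^sup>4\<close>.
  Bilinearity of the commutator modulo the next term then carries a finite generating set of
  elements of order dividing 4 from each factor of the lower central series to the following one.

  For the lower bound on the exponent, make the normal closure of \<open>x\<close> abelian. With \<open>y\<close> acting as
  \<open>t = 1 + s\<close>, the relator becomes \<open>2 - 2 t\<^sup>2 = - 2 s (s + 2)\<close>, while the left-normed commutator
  \<open>[x, y, \<dots>, y]\<close> with \<open>j\<close> letters \<open>y\<close> becomes \<open>s\<^sup>j\<close>, and \<open>2 s\<^sup>j\<close> does not lie in the ideal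
  \<open>(2 s (s + 2), s\<^sup>j\<^sup>+\<^sup>1)\<close> of the ring of integral power series in \<open>s\<close>.
\<close>

section \<open>Commutators and the lower central series\<close>

context group
begin

lemma inv_cancel_left:
  assumes "a \<in> carrier G" "b \<in> carrier G"
  shows "inv a \<otimes> (a \<otimes> b) = b" "a \<otimes> (inv a \<otimes> b) = b"
  using assms by (simp_all flip: m_assoc)

text \<open>Brackets move to the right and adjacent inverse letters cancel, so with these rules the
  simplifier verifies the commutator identities below as identities between words.\<close>

lemmas word_simps = m_assoc inv_mult_group inv_cancel_left commutator_def

lemma commutator_closed [simp, intro]:
  "a \<in> carrier G \<Longrightarrow> b \<in> carrier G \<Longrightarrow> commutator G a b \<in> carrier G"
  by (simp add: commutator_def)

lemma commutator_mult_left: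
  assumes "a \<in> carrier G" "b \<in> carrier G" "g \<in> carrier G"
  shows "commutator G (a \<otimes> b) g = inv b \<otimes> commutator G a g \<otimes> b \<otimes> commutator G b g"
  using assms by (simp add: word_simps)

lemma commutator_mult_right:
  assumes "a \<in> carrier G" "g \<in> carrier G" "h \<in> carrier G"
  shows "commutator G a (g \<otimes> h) = commutator G a h \<otimes> (inv h \<otimes> commutator G a g \<otimes> h)"
  using assms by (simp add: word_simps)

lemma commutator_inv_left:
  assumes "a \<in> carrier G" "g \<in> carrier G"
  shows "commutator G (inv a) g = a \<otimes> inv (commutator G a g) \<otimes> inv a"
  using assms by (simp add: word_simps)

lemma commutator_inv_right:
  assumes "a \<in> carrier G" "g \<in> carrier G"
  shows "commutator G a (inv g) = g \<otimes> inv (commutator G a g) \<otimes> inv g"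
  using assms by (simp add: word_simps)

lemma commutator_one [simp]:
  assumes "a \<in> carrier G"
  shows "commutator G a \<one> = \<one>" "commutator G \<one> a = \<one>" "commutator G a a = \<one>"
  using assms by (simp_all add: word_simps)

lemma inv_commutator:
  assumes "a \<in> carrier G" "b \<in> carrier G"
  shows "inv (commutator G a b) = commutator G b a"
  using assms by (simp add: word_simps)

lemma conj_commutator:
  assumes "a \<in> carrier G" "b \<in> carrier G" "g \<in> carrier G"
  shows "g \<otimes> commutator G a b \<otimes> inv g = commutator G (g \<otimes> a \<otimes> inv g) (g \<otimes> b \<otimes> inv g)"
  using assms by (simp add: word_simps)

lemma conj_eq_mult_commutator:
  assumes "a \<in> carrier G" "g \<in> carrier G"
  shows "inv g \<otimes> a \<otimes> g = a \<otimes> commutator G a g"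
  using assms by (simp add: word_simps)

text \<open>A conjugate of \<open>[a, b]\<close> is the commutator of the conjugates, so normality
  of one term makes the generating set of the next one closed under conjugation.\<close>

lemma lower_central_normal: "lower_central k G \<lhd> G"
proof (induction k rule: induct_nat_012)
  case (ge2 k)
  let ?L = "lower_central (Suc k) G"
  have sub: "?L \<subseteq> carrier G"
    using ge2 by (simp add: normal_imp_subgroup subgroup.subset)
  show ?case
    unfolding lower_central.simps
  proof (rule normal_generateI)
    show "{commutator G a b |a b. a \<in> ?L \<and> b \<in> carrier G} \<subseteq> carrier G"
      using sub by auto
  next
    fix h g assume h: "h \<in> {commutator G a b |a b. a \<in> ?L \<and> b \<in> carrier G}"
      and g: "g \<in> carrier G"
    then obtain a b where ab: "h = commutator G a b" "a \<in> ?L" "b \<in> carrier G"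
      by auto
    have "g \<otimes> h \<otimes> inv g = commutator G (g \<otimes> a \<otimes> inv g) (g \<otimes> b \<otimes> inv g)"
      using ab g sub by (auto intro!: conj_commutator)
    moreover have "g \<otimes> a \<otimes> inv g \<in> ?L"
      using normal_invE(2)[OF ge2(2) g ab(2)] .
    ultimately show "g \<otimes> h \<otimes> inv g \<in> {commutator G a b |a b. a \<in> ?L \<and> b \<in> carrier G}"
      using g ab by blast
  qed
qed (auto simp: normal_self)

lemma lower_central_subgroup: "subgroup (lower_central k G) G"
  using lower_central_normal by (rule normal_imp_subgroup)

lemma lower_central_in_carrier: "a \<in> lower_central k G \<Longrightarrow> a \<in> carrier G"
  using lower_central_subgroup by (rule subgroup.mem_carrier)

lemma commutator_lower_central:
  assumes "a \<in> lower_central k G" "b \<in> carrier G"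
  shows "commutator G a b \<in> lower_central (Suc k) G"
  using assms by (cases k) (auto intro: generate.incl)

lemma lower_central_Suc_subset: "lower_central (Suc k) G \<subseteq> lower_central k G"
proof (cases k)
  case (Suc m)
  interpret N: normal "lower_central k G" G by (rule lower_central_normal)
  have "commutator G a b \<in> lower_central k G" if "a \<in> lower_central k G" "b \<in> carrier G" for a b
  proof -
    \<comment> \<open>Both factors, the inverse of \<open>a\<close> and a conjugate of
      \<open>a\<close>, lie in the normal subgroup that contains \<open>a\<close>.\<close>
    have "commutator G a b = inv a \<otimes> (inv b \<otimes> a \<otimes> b)"
      using that N.mem_carrier by (simp add: word_simps)
    then show ?thesis
      using that N.inv_op_closed1 by simp
  qed
  then show ?thesis
    unfolding Suc lower_central.simps(3)
    by (intro generate_subgroup_incl lower_central_subgroup) (auto simp flip: Suc)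
qed simp

end

lemma (in group_hom) hom_commutator:
  "a \<in> carrier G \<Longrightarrow> b \<in> carrier G \<Longrightarrow> h (commutator G a b) = commutator H (h a) (h b)"
  by (simp add: commutator_def)

text \<open>The form for homomorphisms that need not be onto; it is applied to the map from
  \<open>F2\<close> into an affine group.\<close>

lemma (in group_hom) lower_central_img_subset: "h ` lower_central k G \<subseteq> lower_central k H"
proof (induction k rule: induct_nat_012)
  case (ge2 k)
  let ?S = "{commutator G a b | a b. a \<in> lower_central (Suc k) G \<and> b \<in> carrier G}"
  have "h ` lower_central (Suc (Suc k)) G = generate H (h ` ?S)"
    using G.lower_central_in_carrier by (subst generate_img) auto
  also have "\<dots> \<subseteq> lower_central (Suc (Suc k)) H"
  proof (intro H.generate_subgroup_incl H.lower_central_subgroup image_subsetI)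
    fix z assume "z \<in> ?S"
    then obtain a b where ab: "a \<in> lower_central (Suc k) G" "b \<in> carrier G" "z = commutator G a b"
      by blast
    then have "h z = commutator H (h a) (h b)"
      using hom_commutator G.lower_central_in_carrier by blast
    then show "h z \<in> lower_central (Suc (Suc k)) H"
      using ab ge2 H.commutator_lower_central[of "h a" "Suc k" "h b"] by auto
  qed
  finally show ?case .
qed auto

text \<open>Surjectivity lifts the second entry of a generating commutator and the induction
  hypothesis lifts the first, so the generators upstairs map onto those downstairs.\<close>

lemma (in group_hom) lower_central_img:
  assumes "h ` carrier G = carrier H"
  shows "h ` lower_central k G = lower_central k H"
proof (induction k rule: induct_nat_012)
  case (ge2 k)
  let ?S = "{commutator G a b | a b. a \<in> lower_central (Suc k) G \<and> b \<in> carrier G}"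
  let ?T = "{commutator H a b | a b. a \<in> h ` lower_central (Suc k) G \<and> b \<in> h ` carrier G}"
  have "h ` ?S = ?T"
  proof (intro subset_antisym subsetI)
    fix z assume "z \<in> ?T"
    then obtain a b where "a \<in> lower_central (Suc k) G" "b \<in> carrier G" "z = commutator H (h a) (h b)"
      by auto
    then have "z = h (commutator G a b)" "commutator G a b \<in> ?S"
      using hom_commutator G.lower_central_in_carrier by auto
    then show "z \<in> h ` ?S" by blast
  next
    fix z assume "z \<in> h ` ?S"
    then obtain a b where "a \<in> lower_central (Suc k) G" "b \<in> carrier G" "z = h (commutator G a b)"
      by blast
    then have "z = commutator H (h a) (h b)"
      using hom_commutator G.lower_central_in_carrier by blast
    then show "z \<in> ?T"
      using \<open>a \<in> _\<close> \<open>b \<in> _\<close> by blast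
  qed
  moreover have "h ` lower_central (Suc (Suc k)) G = generate H (h ` ?S)"
    using G.lower_central_in_carrier by (subst generate_img) auto
  ultimately show ?case
    using ge2 assms by simp
qed (use assms in simp_all)

section \<open>Passing generators and torsion on to the next factor\<close>

context group
begin

text \<open>Any subgroup between gamma_(k+2) and gamma_(k+1) is stable under conjugation, because
  conjugating multiplies by a commutator in gamma_(k+2). Modulo the right-hand side \<open>L\<close>
  the commutator is therefore multiplicative in each entry, and generators suffice in both.\<close>

lemma lower_central_Suc_generate:
  assumes S: "S \<subseteq> lower_central k G" "lower_central k G \<subseteq> generate G (S \<union> lower_central (Suc k) G)"
    and Y: "Y \<subseteq> carrier G" "generate G Y = carrier G" and "k > 0"
  shows "lower_central (Suc k) G \<subseteq> generate G
    ({commutator G s x | s x. s \<in> S \<and> x \<in> Y} \<union> lower_central (Suc (Suc k)) G)"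
    (is "_ \<subseteq> generate G (?T \<union> ?N)")
proof -
  define L where "L = generate G (?T \<union> ?N)"
  have Sc: "S \<subseteq> carrier G" using S lower_central_in_carrier by blast
  have T: "?T \<subseteq> lower_central (Suc k) G"
    using S Y commutator_lower_central by blast
  have TN: "?T \<union> ?N \<subseteq> lower_central (Suc k) G"
    using T lower_central_Suc_subset by blast
  then have L_sub: "L \<subseteq> lower_central (Suc k) G"
    unfolding L_def by (intro generate_subgroup_incl lower_central_subgroup)
  have "?T \<union> ?N \<subseteq> carrier G"
    using TN lower_central_in_carrier by blast
  then interpret L: subgroup L G
    unfolding L_def by (rule generate_is_subgroup)
  have N_L: "?N \<subseteq> L" unfolding L_def by (auto intro: generate.incl)
  have conj: "inv g \<otimes> l \<otimes> g \<in> L" if "l \<in> L" "g \<in> carrier G" for l g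
  proof -
    have "commutator G l g \<in> L"
      using that L_sub N_L commutator_lower_central by blast
    then show ?thesis using that by (simp add: conj_eq_mult_commutator)
  qed
  have conj': "g \<otimes> l \<otimes> inv g \<in> L" if "l \<in> L" "g \<in> carrier G" for l g
    using conj[of l "inv g"] that by simp
  \<comment> \<open>The left entry stays in \<open>S\<close> while the right one is built up as a
    word in \<open>Y\<close>.\<close>
  have gens: "commutator G s g \<in> L" if s: "s \<in> S" and g: "g \<in> carrier G" for s g
  proof -
    have "g \<in> generate G Y" using g Y by simp
    then show ?thesis
    proof induction
      case (incl h)
      then show ?case using s unfolding L_def by (auto intro!: generate.incl)
    next
      case (inv h)
      then have "commutator G s h \<in> L" using s unfolding L_def by (auto intro!: generate.incl)
      moreover have "s \<in> carrier G" "h \<in> carrier G" using inv s Sc Y by auto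
      ultimately show ?case
        by (subst commutator_inv_right) (assumption | rule conj' L.m_inv_closed)+
    next
      case (eng h1 h2)
      then have "h1 \<in> carrier G" "h2 \<in> carrier G" using Y by auto
      moreover have "s \<in> carrier G" using s Sc by auto
      ultimately show ?case
        using eng.IH by (subst commutator_mult_right) (assumption | rule conj L.m_closed)+
    qed (use s Sc in auto)
  qed
  \<comment> \<open>Now the left entry is built up; its generators from gamma_(k+1) give commutators
    in gamma_(k+2), which is contained in \<open>L\<close>.\<close>
  have all: "commutator G a g \<in> L" if a: "a \<in> lower_central k G" and g: "g \<in> carrier G" for a g
  proof -
    have *: "h \<in> carrier G" "commutator G h g \<in> L" if "h \<in> S \<union> lower_central (Suc k) G" for h
      using that gens[of h g] g Sc lower_central_in_carrier commutator_lower_central[of h "Suc k" g] N_L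
      by auto
    have sub: "S \<union> lower_central (Suc k) G \<subseteq> carrier G" using *(1) by blast
    have "a \<in> generate G (S \<union> lower_central (Suc k) G)" using S a by blast
    then show ?thesis
    proof induction
      case (inv h)
      then show ?case
        using g *[OF inv.hyps]
        by (subst commutator_inv_left) (assumption | rule conj' L.m_inv_closed)+
    next
      case (eng h1 h2)
      then have "h1 \<in> carrier G" "h2 \<in> carrier G"
        using generate_in_carrier[OF sub] by simp_all
      then show ?case
        using eng.IH g by (subst commutator_mult_left) (assumption | rule conj L.m_closed)+
    next
      case (incl h)
      then show ?case using * by blast
    qed (use g in simp)
  qed
  \<comment> \<open>Positivity makes the recursive equation of \<open>lower_central\<close> apply,
    since the indices 0 and 1 both give the whole group.\<close>
  obtain m where m: "k = Suc m" using \<open>k > 0\<close> gr0_conv_Suc by auto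
  have "lower_central (Suc k) G \<subseteq> L"
    unfolding m lower_central.simps
    using all L.subgroup_axioms m by (intro generate_subgroup_incl) auto
  then show ?thesis by (simp add: L_def)
qed

text \<open>Expanding \<open>[a^n a, g]\<close> produces \<open>[a^n, g] [a, g]\<close> up to the
  factor \<open>[[a^n, g], a]\<close>, which has weight \<open>k + 2\<close>.\<close>

lemma commutator_pow_left_cong:
  assumes a: "a \<in> lower_central k G" and g: "g \<in> carrier G"
  shows "lower_central (Suc (Suc k)) G #> commutator G (a [^] (n::nat)) g
       = lower_central (Suc (Suc k)) G #> commutator G a g [^] n"
proof (induction n)
  case (Suc n)
  interpret N: normal "lower_central (Suc (Suc k)) G" G by (rule lower_central_normal)
  interpret K: subgroup "lower_central k G" G by (rule lower_central_subgroup)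
  let ?N = "lower_central (Suc (Suc k)) G"
  have c: "a \<in> carrier G" using a lower_central_in_carrier by blast
  have pow: "a [^] n \<in> lower_central k G"
    using a by (induction n) auto
  have "commutator G (commutator G (a [^] n) g) a \<in> ?N"
    using a c g pow by (auto intro!: commutator_lower_central simp del: lower_central.simps)
  then have N: "?N #> commutator G (commutator G (a [^] n) g) a = ?N"
    using N.rcos_const by blast
  have "commutator G (a [^] Suc n) g
      = commutator G (a [^] n) g \<otimes> commutator G (commutator G (a [^] n) g) a \<otimes> commutator G a g"
    using c g by (simp add: commutator_mult_left conj_eq_mult_commutator)
  then have "?N #> commutator G (a [^] Suc n) g
      = (?N #> commutator G (a [^] n) g) <#> (?N #> commutator G (commutator G (a [^] n) g) a)
          <#> (?N #> commutator G a g)"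
    using c g by (simp add: N.rcos_sum del: lower_central.simps)
  also have "\<dots> = (?N #> commutator G a g [^] n) <#> ?N <#> (?N #> commutator G a g)"
    by (simp only: N Suc.IH)
  also have "\<dots> = (?N #> commutator G a g [^] n) <#> (?N #> \<one>) <#> (?N #> commutator G a g)"
    using N.subset by (simp del: lower_central.simps)
  also have "\<dots> = ?N #> commutator G a g [^] Suc n"
    using c g by (simp add: N.rcos_sum del: lower_central.simps)
  finally show ?case .
qed (use g in simp)

text \<open>This hands torsion on: \<open>[a^n, g]\<close> has weight \<open>k + 2\<close> as soon
  as \<open>a^n\<close> has weight \<open>k + 1\<close>, and it agrees with \<open>[a, g]^n\<close>
  modulo gamma_(k+2).\<close>

lemma pow_commutator_lower_central:
  assumes "a \<in> lower_central k G" "g \<in> carrier G" "a [^] (n::nat) \<in> lower_central (Suc k) G"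
  shows "commutator G a g [^] n \<in> lower_central (Suc (Suc k)) G"
proof -
  interpret N: normal "lower_central (Suc (Suc k)) G" G by (rule lower_central_normal)
  have c: "a \<in> carrier G" using assms lower_central_in_carrier by blast
  have "commutator G (a [^] n) g \<in> lower_central (Suc (Suc k)) G"
    using assms by (intro commutator_lower_central)
  then have "lower_central (Suc (Suc k)) G #> commutator G a g [^] n = lower_central (Suc (Suc k)) G"
    using N.rcos_const commutator_pow_left_cong[OF assms(1,2), of n] by simp
  moreover have "commutator G a g [^] n \<in> carrier G" using c assms(2) by simp
  ultimately show ?thesis
    by (rule coset_join1) (rule N.subgroup_axioms)
qed

end

section \<open>Torsion in the lower central factors\<close>

text \<open>Adjoining one generator \<open>s\<close> multiplies the size by at most
  \<open>n\<close>, since every element has the form \<open>s^i h\<close> with \<open>i < n\<close>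
  and \<open>h\<close> generated by the others.\<close>

lemma (in comm_group) finite_generate_torsion:
  assumes "finite S" "S \<subseteq> carrier G" "\<And>s. s \<in> S \<Longrightarrow> s [^] n = \<one>" "n > (0::nat)"
  shows "finite (generate G S)"
  using assms(1-3)
proof (induction S)
  case (insert s S)
  then have s: "s \<in> carrier G" "s [^] n = \<one>" and S: "S \<subseteq> carrier G" by auto
  interpret S: subgroup "generate G S" G using S by (rule generate_is_subgroup)
  let ?K = "{s [^] i \<otimes> h | i h. i < n \<and> h \<in> generate G S}"
  have pow: "s [^] i \<otimes> h \<in> ?K" if "h \<in> generate G S" for i :: nat and h
  proof -
    have "s [^] i = s [^] (n * (i div n) + i mod n)" by simp
    also have "\<dots> = s [^] (i mod n)"
      using s by (simp only: nat_pow_mult[symmetric] nat_pow_pow[symmetric] nat_pow_one l_one nat_pow_closed)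
    finally have "s [^] i \<otimes> h = s [^] (i mod n) \<otimes> h" by simp
    moreover have "i mod n < n" using assms(4) by simp
    ultimately show ?thesis using that by blast
  qed
  \<comment> \<open>Torsion turns inverses into natural powers, so exponents need only range over
    natural numbers.\<close>
  have inv: "inv s = s [^] (n - 1)"
  proof (rule inv_equality)
    have "s [^] (n - 1) \<otimes> s = s [^] Suc (n - 1)" by simp
    then show "s [^] (n - 1) \<otimes> s = \<one>" using s assms(4) by simp
  qed (use s in auto)
  have "g \<in> ?K" if "g \<in> generate G (insert s S)" for g
    using that
  proof induction
    case one
    then show ?case using pow[of \<one> 0] S.one_closed by simp
  next
    case (incl h)
    then show ?case
    proof (cases "h = s")
      case True
      then show ?thesis using pow[of \<one> 1] s by (simp add: generate.one)
    next
      case False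
      then show ?thesis using incl pow[of h 0] S by (auto intro: generate.incl)
    qed
  next
    case (inv h)
    then show ?case
    proof (cases "h = s")
      case True
      then show ?thesis using pow[of \<one> "n - 1"] s \<open>inv s = _\<close> by (simp add: generate.one)
    next
      case False
      then have "inv h \<in> generate G S" "inv h \<in> carrier G" using inv S by (auto intro: generate.inv)
      then show ?thesis using pow[of "inv h" 0] by simp
    qed
  next
    case (eng h1 h2)
    obtain i :: nat and g1 where 1: "h1 = s [^] i \<otimes> g1" "g1 \<in> generate G S"
      using eng.IH(1) by blast
    obtain j :: nat and g2 where 2: "h2 = s [^] j \<otimes> g2" "g2 \<in> generate G S"
      using eng.IH(2) by blast
    have "h1 \<otimes> h2 = (s [^] i \<otimes> s [^] j) \<otimes> (g1 \<otimes> g2)"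
      using s 1 2 S.mem_carrier by (simp add: m_ac)
    also have "s [^] i \<otimes> s [^] j = s [^] (i + j)" using s by (simp add: nat_pow_mult)
    finally show ?case using pow 1 2 S.m_closed by simp
  qed
  then have "generate G (insert s S) \<subseteq> ?K" by blast
  moreover have "finite ?K" using insert by (intro finite_image_set2) auto
  ultimately show ?case by (rule finite_subset)
qed (simp add: generate_empty)

lemma (in comm_group) generate_torsion:
  assumes "S \<subseteq> carrier G" "\<And>s. s \<in> S \<Longrightarrow> s [^] (n::nat) = \<one>" "g \<in> generate G S"
  shows "g [^] n = \<one>"
  using assms(3)
proof induction
  case (inv h)
  then have "h \<in> carrier G" "h [^] n = \<one>" using assms by auto
  then show ?case by (simp add: nat_pow_inv)
next
  case (eng h1 h2)
  then have "h1 \<in> carrier G" "h2 \<in> carrier G" using assms generate_in_carrier by auto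
  then show ?case using eng by (simp add: nat_pow_distrib)
qed (use assms in auto)

section \<open>Exponents and cyclic groups\<close>

context group
begin

text \<open>The order of \<open>c\<close> divides every exponent that kills the group, which gives
  minimality.\<close>

lemma group_exponent_eqI:
  assumes "c \<in> carrier G" "local.ord c = n" "n > 0" "\<And>g. g \<in> carrier G \<Longrightarrow> g [^] n = \<one>"
  shows "group_exponent G = n"
proof -
  have "(LEAST n::nat. n > 0 \<and> (\<forall>x\<in>carrier G. x [^] n = \<one>)) = n"
  proof (rule Least_equality)
    fix m :: nat assume "m > 0 \<and> (\<forall>x\<in>carrier G. x [^] m = \<one>)"
    then show "n \<le> m" using assms(1,2) pow_eq_id dvd_imp_le by blast
  qed (use assms in auto)
  then show ?thesis unfolding group_exponent_def using assms by auto
qed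

text \<open>The map \<open>?f\<close> goes from residues to powers of \<open>c\<close>; reducing the
  exponent modulo \<open>n\<close> is harmless because \<open>c\<close> has order \<open>n\<close>.
  The isomorphism is inverted at the end.\<close>

lemma cyclic_iso_integer_mod_group:
  assumes "c \<in> carrier G" "local.ord c = n" "n > 0" "generate G {c} = carrier G"
  shows "G \<cong> integer_mod_group n"
proof -
  let ?f = "\<lambda>i::int. c [^] i"
  have eq: "c [^] i = c [^] j \<longleftrightarrow> int n dvd i - j" for i j :: int
    using assms int_pow_eq[of c i j] by (simp add: dvd_diff_commute)
  have "?f \<in> iso (integer_mod_group n) G"
  proof (rule isoI)
    show "?f \<in> hom (integer_mod_group n) G"
    proof (rule homI)
      fix i j :: int
      have "c [^] ((i + j) mod int n) = c [^] (i + j)"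
        unfolding eq by (simp add: mod_eq_dvd_iff flip: mod_eq_dvd_iff)
      then show "c [^] (i \<otimes>\<^bsub>integer_mod_group n\<^esub> j) = c [^] i \<otimes> c [^] j"
        using assms by (simp add: int_pow_mult)
    qed (use assms in simp)
    show "bij_betw ?f (carrier (integer_mod_group n)) (carrier G)"
      unfolding bij_betw_def
    proof
      show "inj_on ?f (carrier (integer_mod_group n))"
        using assms(3) by (auto simp: inj_on_def eq carrier_integer_mod_group mod_eq_dvd_iff[symmetric])
      have "g \<in> ?f ` {0..<int n}" if g: "g \<in> carrier G" for g
      proof -
        obtain i :: int where "g = c [^] i"
          using g generate_pow[OF assms(1)] assms(4) by auto
        moreover have "c [^] i = c [^] (i mod int n)"
          unfolding eq by (simp flip: mod_eq_dvd_iff)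
        ultimately show ?thesis using assms(3) by auto
      qed
      then show "?f ` carrier (integer_mod_group n) = carrier G"
        using assms by (auto simp: carrier_integer_mod_group)
    qed
  qed
  then show ?thesis
    by (rule group.iso_sym[OF group_integer_mod_group is_isoI])
qed

lemma ord_eq_4:
  assumes "c \<in> carrier G" "c [^] (4::nat) = \<one>" "c [^] (2::nat) \<noteq> \<one>"
  shows "local.ord c = 4"
proof -
  have d: "local.ord c dvd 4" "\<not> local.ord c dvd 2"
    using assms by (simp_all add: pow_eq_id)
  then have "local.ord c \<in> {1,2,3,4}"
    using dvd_imp_le[of "local.ord c" 4] by (cases "local.ord c = 0") auto
  then show ?thesis using d by auto
qed

section \<open>The lower central factors as abelian quotient groups\<close>

context
  fixes k :: nat
begin

interpretation N: normal "lower_central (Suc k) G" "G\<lparr>carrier := lower_central k G\<rparr>"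
  by (rule normal_restrict_supergroup[OF lower_central_subgroup lower_central_normal lower_central_Suc_subset])

interpretation K: normal "lower_central (Suc k) G" G
  by (rule lower_central_normal)

abbreviation (input) "factor_class \<equiv> \<lambda>a. lower_central (Suc k) G #> a"

lemma carrier_lower_central_factor:
  "carrier (lower_central_factor k G) = factor_class ` lower_central k G"
  by (auto simp: lower_central_factor_def carrier_FactGroup r_coset_def)

lemma group_hom_lower_central_factor:
  "group_hom (G\<lparr>carrier := lower_central k G\<rparr>) (lower_central_factor k G) factor_class"
proof -
  \<comment> \<open>A coset depends only on the multiplication, so cosets formed in the subgroup are
    cosets formed in \<open>G\<close>.\<close>
  have "(\<lambda>a. lower_central (Suc k) G #>\<^bsub>G\<lparr>carrier := lower_central k G\<rparr>\<^esub> a) = factor_class"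
    by (simp add: r_coset_def)
  then show ?thesis
    using N.r_coset_hom_Mod N.factorgroup_is_group N.is_group
    by (simp add: group_hom_def group_hom_axioms_def lower_central_factor_def)
qed

lemma one_lower_central_factor: "\<one>\<^bsub>lower_central_factor k G\<^esub> = lower_central (Suc k) G"
  by (simp add: lower_central_factor_def)

lemma factor_class_eq_one_iff:
  "a \<in> carrier G \<Longrightarrow> factor_class a = \<one>\<^bsub>lower_central_factor k G\<^esub> \<longleftrightarrow> a \<in> lower_central (Suc k) G"
  unfolding one_lower_central_factor
  using coset_join1[OF _ _ K.subgroup_axioms] K.rcos_const by auto

lemma factor_class_pow:
  assumes "a \<in> lower_central k G"
  shows "factor_class a [^]\<^bsub>lower_central_factor k G\<^esub> (n::nat) = factor_class (a [^] n)"
proof -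
  interpret h: group_hom "G\<lparr>carrier := lower_central k G\<rparr>" "lower_central_factor k G" factor_class
    by (rule group_hom_lower_central_factor)
  show ?thesis
    using h.hom_nat_pow[of a n] assms by (simp add: nat_pow_consistent[symmetric])
qed

text \<open>The commutator of \<open>a\<close> in gamma_k with any element of \<open>G\<close>
  already lies in gamma_(k+1), and \<open>ab\<close> differs from \<open>ba\<close> by
  \<open>[a, b]\<close>.\<close>

lemma comm_group_lower_central_factor: "comm_group (lower_central_factor k G)"
proof -
  interpret h: group_hom "G\<lparr>carrier := lower_central k G\<rparr>" "lower_central_factor k G" factor_class
    by (rule group_hom_lower_central_factor)
  show ?thesis
  proof (rule h.H.group_comm_groupI)
    fix u v assume "u \<in> carrier (lower_central_factor k G)" "v \<in> carrier (lower_central_factor k G)"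
    then obtain a b where ab: "u = factor_class a" "v = factor_class b" "a \<in> lower_central k G" "b \<in> lower_central k G"
      by (auto simp: carrier_lower_central_factor)
    then have c: "a \<in> carrier G" "b \<in> carrier G"
      using lower_central_in_carrier by auto
    have "commutator G a b \<in> lower_central (Suc k) G"
      using ab c by (intro commutator_lower_central)
    then have "factor_class (commutator G a b) = factor_class \<one>"
      using K.rcos_const K.subset by simp
    then have "factor_class (b \<otimes> a) = factor_class (b \<otimes> a) <#> factor_class (commutator G a b)"
      using c K.rcos_sum[of "b \<otimes> a" \<one>] by simp
    also have "\<dots> = factor_class (b \<otimes> a \<otimes> commutator G a b)"
      using c by (simp add: K.rcos_sum)
    also have "b \<otimes> a \<otimes> commutator G a b = a \<otimes> b"
      using c by (simp add: word_simps)
    finally show "u \<otimes>\<^bsub>lower_central_factor k G\<^esub> v = v \<otimes>\<^bsub>lower_central_factor k G\<^esub> u"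
      using ab h.hom_mult[of a b] h.hom_mult[of b a] by simp
  qed
qed

text \<open>The generators taken from gamma_(k+1) become trivial in the factor, which leaves the
  classes of \<open>S\<close>.\<close>

lemma generate_lower_central_factor:
  assumes "S \<subseteq> lower_central k G" "lower_central k G \<subseteq> generate G (S \<union> lower_central (Suc k) G)"
  shows "carrier (lower_central_factor k G) = generate (lower_central_factor k G) (factor_class ` S)"
proof -
  let ?Q = "lower_central_factor k G"
  interpret h: group_hom "G\<lparr>carrier := lower_central k G\<rparr>" ?Q factor_class
    by (rule group_hom_lower_central_factor)
  let ?S = "S \<union> lower_central (Suc k) G"
  have S: "?S \<subseteq> lower_central k G"
    using assms lower_central_Suc_subset by auto
  have "carrier ?Q \<subseteq> factor_class ` generate G ?S"
    using assms(2) by (auto simp: carrier_lower_central_factor)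
  also have "\<dots> = generate ?Q (factor_class ` ?S)"
    using h.generate_img[of ?S] S generate_consistent[OF S lower_central_subgroup] by simp
  also have "\<dots> \<subseteq> generate ?Q (factor_class ` S)"
  proof (rule h.H.generate_subgroup_incl)
    show sub: "subgroup (generate ?Q (factor_class ` S)) ?Q"
      using S by (intro h.H.generate_is_subgroup) (auto simp: carrier_lower_central_factor)
    have "factor_class a \<in> generate ?Q (factor_class ` S)" if "a \<in> lower_central (Suc k) G" for a
      using that K.rcos_const subgroup.one_closed[OF sub] one_lower_central_factor by simp
    then show "factor_class ` ?S \<subseteq> generate ?Q (factor_class ` S)"
      by (auto intro: generate.incl)
  qed
  finally show ?thesis
    using S h.H.generate_incl[of "factor_class ` S"] by (force simp: carrier_lower_central_factor)
qed

end

text \<open>Induction on the weight: the commutators \<open>[s, y]\<close> with \<open>s\<close> in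
  the old set and \<open>y\<close> in \<open>Y\<close> form the next set. The existential is needed
  because the set changes at each step.\<close>

lemma lower_central_torsion_generators:
  assumes fin: "finite S" and S: "S \<subseteq> lower_central m G"
      "lower_central m G \<subseteq> generate G (S \<union> lower_central (Suc m) G)"
      "\<And>s. s \<in> S \<Longrightarrow> s [^] (n::nat) \<in> lower_central (Suc m) G"
    and Y: "finite Y" "Y \<subseteq> carrier G" "generate G Y = carrier G"
    and "0 < m" "m \<le> k"
  shows "\<exists>S. finite S \<and> S \<subseteq> lower_central k G
    \<and> lower_central k G \<subseteq> generate G (S \<union> lower_central (Suc k) G)
    \<and> (\<forall>s\<in>S. s [^] n \<in> lower_central (Suc k) G)"
  using \<open>m \<le> k\<close>
proof (induction k rule: dec_induct)
  case base
  then show ?case using fin S by blast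
next
  case (step k)
  then obtain S where S: "finite S" "S \<subseteq> lower_central k G"
      "lower_central k G \<subseteq> generate G (S \<union> lower_central (Suc k) G)"
      "\<And>s. s \<in> S \<Longrightarrow> s [^] n \<in> lower_central (Suc k) G"
    by blast
  have "k > 0" using step assms by simp
  let ?T = "{commutator G s y | s y. s \<in> S \<and> y \<in> Y}"
  have "?T = (\<lambda>(s, y). commutator G s y) ` (S \<times> Y)" by auto
  then have "finite ?T" using S Y by simp
  moreover have "?T \<subseteq> lower_central (Suc k) G"
    using S Y commutator_lower_central by blast
  moreover have "\<forall>t\<in>?T. t [^] n \<in> lower_central (Suc (Suc k)) G"
    using S Y pow_commutator_lower_central by blast
  ultimately show ?case
    using lower_central_Suc_generate[OF S(2,3) Y(2,3) \<open>k > 0\<close>] by blast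
qed

end

section \<open>Quotients and free groups\<close>

lemma normal_normal_closure:
  assumes "group G" "S \<subseteq> carrier G"
  shows "normal_closure G S \<lhd> G"
proof -
  interpret group G by fact
  show ?thesis
    unfolding normal_closure_def
  proof (rule normal_invI)
    show "subgroup (\<Inter>{N. N \<lhd> G \<and> S \<subseteq> N}) G"
      \<comment> \<open>The whole group belongs to the family, so the intersection is over a
        nonempty set of subgroups.\<close>
      using normal_self assms(2) by (intro subgroups_Inter) (auto dest: normal_imp_subgroup)
  qed (auto dest: normal.inv_op_closed2)
qed

lemma normal_closure_superset: "S \<subseteq> normal_closure G S"
  by (auto simp: normal_closure_def)

lemma normal_closure_minimal: "N \<lhd> G \<Longrightarrow> S \<subseteq> N \<Longrightarrow> normal_closure G S \<subseteq> N"
  by (auto simp: normal_closure_def)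

text \<open>Equal kernels mean that \<open>f\<close> and \<open>g\<close> identify the same pairs,
  so applying \<open>g\<close> to any preimage under \<open>f\<close> is well defined and injective.
  The relation between \<open>h\<close>, \<open>f\<close> and \<open>g\<close> is kept in order to
  follow generators.\<close>

lemma iso_of_epis_same_kernel:
  assumes f: "group_hom G A f" "f ` carrier G = carrier A"
    and g: "group_hom G B g" "g ` carrier G = carrier B"
    and ker: "kernel G A f = kernel G B g"
  shows "\<exists>h \<in> iso A B. \<forall>x\<in>carrier G. h (f x) = g x"
proof -
  interpret f: group_hom G A f by fact
  interpret g: group_hom G B g by fact
  have eq: "f x = f y \<longleftrightarrow> g x = g y" if "x \<in> carrier G" "y \<in> carrier G" for x y
  proof -
    have "f x = f y \<longleftrightarrow> x \<otimes>\<^bsub>G\<^esub> inv\<^bsub>G\<^esub> y \<in> kernel G A f"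
      using that by (simp add: kernel_def f.H.inv_solve_right')
    also have "\<dots> \<longleftrightarrow> g x = g y"
      unfolding ker using that by (simp add: kernel_def g.H.inv_solve_right')
    finally show ?thesis .
  qed
  define h where "h = (\<lambda>a. g (inv_into (carrier G) f a))"
  have h: "h (f x) = g x" if "x \<in> carrier G" for x
    unfolding h_def using that eq inv_into_into[of "f x" f "carrier G"] f_inv_into_f[of "f x" f "carrier G"]
    by blast
  have "h \<in> iso A B"
  proof (rule isoI)
    have ex: "\<exists>x\<in>carrier G. a = f x" if "a \<in> carrier A" for a using f(2) that by blast
    show "h \<in> hom A B"
    proof (rule homI)
      fix a b assume "a \<in> carrier A" "b \<in> carrier A"
      then obtain x y where "x \<in> carrier G" "y \<in> carrier G" "a = f x" "b = f y" using ex by metis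
      then show "h (a \<otimes>\<^bsub>A\<^esub> b) = h a \<otimes>\<^bsub>B\<^esub> h b"
        using h[of "x \<otimes>\<^bsub>G\<^esub> y"] h by simp
    qed (use ex h in force)
    have "h ` carrier A = g ` carrier G"
      unfolding f(2)[symmetric] using h by force
    moreover have "inj_on h (carrier A)"
      unfolding f(2)[symmetric] using h eq by (auto simp: inj_on_def)
    ultimately show "bij_betw h (carrier A) (carrier B)"
      using g(2) by (simp add: bij_betw_def)
  qed
  then show ?thesis using h by blast
qed

lemma (in normal) group_hom_Mod: "group_hom G (G Mod H) (\<lambda>a. H #> a)"
  using r_coset_hom_Mod factorgroup_is_group is_group
  by (simp add: group_hom_def group_hom_axioms_def)

lemma (in normal) kernel_Mod: "kernel G (G Mod H) (\<lambda>a. H #> a) = H"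
proof (intro subset_antisym subsetI)
  fix a assume "a \<in> kernel G (G Mod H) (\<lambda>a. H #> a)"
  then show "a \<in> H" using coset_join1[OF _ _ subgroup_axioms] by (simp add: kernel_def)
qed (use rcos_const in \<open>auto simp: kernel_def\<close>)

lemma (in normal) Mod_eq_one_iff: "a \<in> carrier G \<Longrightarrow> H #> a = H \<longleftrightarrow> a \<in> H"
  using kernel_Mod by (auto simp: kernel_def)

text \<open>Later arguments use \<open>impose\<close> and \<open>impose_class\<close> only through
  these three facts.\<close>

lemma impose_class_hom:
  assumes "group G" "relators G R \<subseteq> carrier G"
  shows "group_hom G (impose G R) (impose_class G R)"
    and "impose_class G R ` carrier G = carrier (impose G R)"
    and "kernel G (impose G R) (impose_class G R) = normal_closure G (relators G R)"
proof -
  interpret N: normal "normal_closure G (relators G R)" G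
    using assms by (rule normal_normal_closure)
  have *: "impose_class G R = (\<lambda>a. normal_closure G (relators G R) #>\<^bsub>G\<^esub> a)"
    by (simp add: fun_eq_iff impose_class_def)
  show "group_hom G (impose G R) (impose_class G R)"
    and "impose_class G R ` carrier G = carrier (impose G R)"
    and "kernel G (impose G R) (impose_class G R) = normal_closure G (relators G R)"
    unfolding * impose_def
    by (fact N.group_hom_Mod, simp add: carrier_FactGroup, fact N.kernel_Mod)
qed

text \<open>The projection is onto, so it carries gamma_k to gamma_k of the quotient, and it kills
  gamma_k. Commutators of weight \<open>k\<close> can thus be replaced by 1 in the quotient.\<close>

lemma (in group) lower_central_Mod_trivial:
  "lower_central k (G Mod lower_central k G) = {\<one>\<^bsub>G Mod lower_central k G\<^esub>}"
proof -
  interpret N: normal "lower_central k G" G by (rule lower_central_normal)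
  interpret h: group_hom G "G Mod lower_central k G" "\<lambda>a. lower_central k G #> a"
    by (rule N.group_hom_Mod)
  have "(\<lambda>a. lower_central k G #> a) ` lower_central k G = lower_central k (G Mod lower_central k G)"
    by (intro h.lower_central_img) (simp add: carrier_FactGroup)
  moreover have "(\<lambda>a. lower_central k G #> a) ` lower_central k G = (\<lambda>_. lower_central k G) ` lower_central k G"
    using N.rcos_const by (intro image_cong) simp_all
  ultimately show ?thesis using image_constant[OF N.one_closed, of "lower_central k G"]
    by (simp only: one_FactGroup)
qed

lemma (in group) commute_iff_commutator:
  assumes "a \<in> carrier G" "b \<in> carrier G"
  shows "a \<otimes> b = b \<otimes> a \<longleftrightarrow> commutator G a b = \<one>"
proof -
  have "a \<otimes> b = b \<otimes> a \<otimes> commutator G a b"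
    using assms by (simp add: word_simps)
  moreover have "b \<otimes> a \<otimes> commutator G a b = b \<otimes> a \<otimes> \<one> \<longleftrightarrow> commutator G a b = \<one>"
    using assms by (simp del: r_one)
  ultimately show ?thesis using assms by simp
qed

lemma (in group) conj_eq_one_iff:
  "a \<in> carrier G \<Longrightarrow> g \<in> carrier G \<Longrightarrow> g \<otimes> a \<otimes> inv g = \<one> \<longleftrightarrow> a = \<one>"
  by (simp add: inv_solve_right')

lemma (in group_hom) normal_vimage:
  assumes "N \<lhd> H"
  shows "{a \<in> carrier G. h a \<in> N} \<lhd> G"
proof -
  interpret N: normal N H by fact
  show ?thesis
  proof (rule G.normal_invI)
    show "subgroup {a \<in> carrier G. h a \<in> N} G"
      by (rule G.subgroupI) (auto intro!: exI[of _ "\<one>\<^bsub>G\<^esub>"])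
  qed (auto intro: N.inv_op_closed2)
qed

section \<open>The universal property of free groups\<close>

definition free_lift :: "('b, 'c) monoid_scheme \<Rightarrow> ('a \<Rightarrow> 'b) \<Rightarrow> 'a letter list \<Rightarrow> 'b" where
  "free_lift H f w =
     foldr (\<lambda>p h. (if snd p then f (fst p) else inv\<^bsub>H\<^esub> f (fst p)) \<otimes>\<^bsub>H\<^esub> h) w \<one>\<^bsub>H\<^esub>"

text \<open>Products of reduced words are iterated left multiplications by letters. Hence only
  \<open>lmult\<close> has to be checked, where a letter meeting its flip cancels in
  \<open>H\<close> as well.\<close>

lemma group_hom_free_lift:
  assumes "group H" and f: "\<And>a. a \<in> A \<Longrightarrow> f a \<in> carrier H"
  shows "group_hom (free_group A) H (free_lift H f)"
proof -
  interpret H: group H by fact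
  let ?val = "\<lambda>p. if snd p then f (fst p) else inv\<^bsub>H\<^esub> f (fst p)"
  have lift_Cons: "free_lift H f (p # w) = ?val p \<otimes>\<^bsub>H\<^esub> free_lift H f w" for p w
    by (simp add: free_lift_def)
  have val: "?val p \<in> carrier H" if "p \<in> A \<times> UNIV" for p
    using f that by (cases p) auto
  have closed: "free_lift H f w \<in> carrier H" if "w \<in> lists (A \<times> UNIV)" for w
    using that by induction (auto simp: lift_Cons f, simp add: free_lift_def)
  have lmult: "free_lift H f (lmult p w) = ?val p \<otimes>\<^bsub>H\<^esub> free_lift H f w"
    if "p \<in> A \<times> UNIV" "w \<in> lists (A \<times> UNIV)" for p w
  proof (cases w)
    case (Cons q w')
    then have w': "free_lift H f w' \<in> carrier H" using that closed by simp
    show ?thesis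
    proof (cases "q = flip p")
      case True
      have "?val p \<otimes>\<^bsub>H\<^esub> (?val q \<otimes>\<^bsub>H\<^esub> free_lift H f w') = free_lift H f w'"
        using that(1) w' f True by (cases p) (auto simp: flip_def H.inv_cancel_left)
      moreover have "free_lift H f w = ?val q \<otimes>\<^bsub>H\<^esub> free_lift H f w'"
        unfolding Cons by (rule lift_Cons)
      moreover have "lmult p w = w'" using Cons True by simp
      ultimately show ?thesis by (simp only:)
    qed (simp add: Cons lift_Cons)
  qed (simp add: lift_Cons)
  have foldr: "free_lift H f (foldr lmult u w) = free_lift H f u \<otimes>\<^bsub>H\<^esub> free_lift H f w"
    if "u \<in> lists (A \<times> UNIV)" "w \<in> lists (A \<times> UNIV)" for u w
    using that(1)
  proof induction
    case Nil
    then show ?case using closed that by (simp add: free_lift_def[of _ _ "[]"])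
  next
    case (Cons p u)
    then show ?case
      using lmult[OF _ foldr_lmult_lists[OF _ that(2)], of p u] closed[of u] closed[OF that(2)] val[of p]
      by (simp only: foldr.simps o_apply lift_Cons H.m_assoc)
  qed
  show ?thesis
    using group_free_group closed foldr H.is_group
    by (auto simp: group_hom_def group_hom_axioms_def hom_def free_group_def)
qed

lemma free_lift_free_gen:
  assumes "group H" "f a \<in> carrier H"
  shows "free_lift H f (free_gen a) = f a"
  using assms by (simp add: free_lift_def free_gen_def group.is_monoid monoid.r_one)

text \<open>A reduced word \<open>p # w\<close> is the product of \<open>[p]\<close> and
  \<open>w\<close> without cancellation, and \<open>[p]\<close> is a generator or the inverse of
  one.\<close>

lemma generate_free_group: "generate (free_group A) (free_gen ` A) = carrier (free_group A)"
proof (intro subset_antisym subsetI)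
  interpret group "free_group A" by (rule group_free_group)
  have gen: "free_gen ` A \<subseteq> carrier (free_group A)"
    by (auto simp: free_gen_def free_group_def)
  show "w \<in> carrier (free_group A)" if "w \<in> generate (free_group A) (free_gen ` A)" for w
    using that gen generate_in_carrier by blast
  fix w assume "w \<in> carrier (free_group A)"
  then have "w \<in> lists (A \<times> UNIV)" "reduced w" by (auto simp: free_group_def)
  then show "w \<in> generate (free_group A) (free_gen ` A)"
  proof (induction w)
    case Nil
    then show ?case using generate.one[of "free_group A"] by (simp add: free_group_def)
  next
    case (Cons p w)
    obtain a b where p: "p = (a, b)" "a \<in> A" using Cons by auto
    have "[p] \<in> generate (free_group A) (free_gen ` A)"
    proof (cases b)
      case True
      then show ?thesis using p by (auto simp: free_gen_def intro!: generate.incl)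
    next
      case False
      have "inv\<^bsub>free_group A\<^esub> (free_gen a) = [p]"
        using p False by (intro inv_equality) (auto simp: free_gen_def free_group_def flip_def)
      then show ?thesis using p generate.inv[of "free_gen a" "free_gen ` A" "free_group A"] by auto
    qed
    moreover have "w \<in> generate (free_group A) (free_gen ` A)"
      using Cons.IH Cons.prems reduced_tl[of p w] by simp
    ultimately have "[p] \<otimes>\<^bsub>free_group A\<^esub> w \<in> generate (free_group A) (free_gen ` A)"
      by (rule generate.eng)
    then show ?case using Cons by (simp add: free_group_def lmult_reduced)
  qed
qed

section \<open>The relator in class 3\<close>

text \<open>The relator of \<open>G2_relation\<close> over an arbitrary group, so that it can be
  carried along homomorphisms from \<open>F2\<close> to \<open>G2\<close>, to nilpotent quotients
  and to affine groups.\<close>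

definition G2_word :: "('a, 'b) monoid_scheme \<Rightarrow> 'a \<Rightarrow> 'a \<Rightarrow> 'a" where
  "G2_word G x y =
     (x \<otimes>\<^bsub>G\<^esub> inv\<^bsub>G\<^esub> y \<otimes>\<^bsub>G\<^esub> inv\<^bsub>G\<^esub> x \<otimes>\<^bsub>G\<^esub> y \<otimes>\<^bsub>G\<^esub> x)
     \<otimes>\<^bsub>G\<^esub> inv\<^bsub>G\<^esub> (inv\<^bsub>G\<^esub> y [^]\<^bsub>G\<^esub> (2::nat) \<otimes>\<^bsub>G\<^esub> x \<otimes>\<^bsub>G\<^esub> y \<otimes>\<^bsub>G\<^esub> inv\<^bsub>G\<^esub> x \<otimes>\<^bsub>G\<^esub> inv\<^bsub>G\<^esub> y
             \<otimes>\<^bsub>G\<^esub> x \<otimes>\<^bsub>G\<^esub> y [^]\<^bsub>G\<^esub> (2::nat))"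

lemma (in group_hom) hom_G2_word:
  "x \<in> carrier G \<Longrightarrow> y \<in> carrier G \<Longrightarrow> h (G2_word G x y) = G2_word H (h x) (h y)"
  by (simp add: G2_word_def hom_nat_pow)

lemma (in group) G2_word_closed [simp]:
  "x \<in> carrier G \<Longrightarrow> y \<in> carrier G \<Longrightarrow> G2_word G x y \<in> carrier G"
  by (simp add: G2_word_def)

text \<open>Conjugation by \<open>y\<close> sends \<open>x\<close> to \<open>x d\<close> and
  \<open>d\<close> to \<open>d e\<close> and fixes \<open>e\<close>. The two sides of the relation
  are then \<open>x d^-1\<close> and \<open>x d^3 e^2\<close>.\<close>

lemma (in group) G2_word_class3:
  assumes x: "x \<in> carrier G" and y: "y \<in> carrier G"
    and ex: "commutator G (commutator G x y) y \<otimes> x = x \<otimes> commutator G (commutator G x y) y"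
    and ey: "commutator G (commutator G x y) y \<otimes> y = y \<otimes> commutator G (commutator G x y) y"
  shows "G2_word G x y = x \<otimes> (commutator G y x [^] (4::nat)
      \<otimes> inv (commutator G (commutator G x y) y [^] (2::nat))) \<otimes> inv x"
proof -
  define d where "d = commutator G x y"
  define e where "e = commutator G d y"
  have c: "d \<in> carrier G" "e \<in> carrier G" unfolding e_def d_def using x y by auto
  have e_inv: "e \<otimes> inv z = inv z \<otimes> e" if "z \<in> carrier G" "e \<otimes> z = z \<otimes> e" for z
    using that c by (metis inv_closed inv_solve_left inv_solve_right m_assoc m_closed)
  have e_mult: "e \<otimes> (z \<otimes> w) = (z \<otimes> w) \<otimes> e"
    if "z \<in> carrier G" "w \<in> carrier G" "e \<otimes> z = z \<otimes> e" "e \<otimes> w = w \<otimes> e" for z w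
    using that c by (metis m_assoc)
  \<comment> \<open>\<open>d\<close> is a word in \<open>x\<close> and \<open>y\<close>, with both
    of which \<open>e\<close> commutes.\<close>
  have ed: "e \<otimes> d = d \<otimes> e"
    unfolding d_def commutator_def
    using x y ex ey unfolding d_def[symmetric] e_def[symmetric]
    by (intro e_mult e_inv m_closed inv_closed) auto
  have ed': "e \<otimes> (d \<otimes> z) = d \<otimes> (e \<otimes> z)" if "z \<in> carrier G" for z
    using ed c that by (metis m_assoc)
  have xy: "inv y \<otimes> x \<otimes> y = x \<otimes> d" and dy: "inv y \<otimes> d \<otimes> y = d \<otimes> e"
    unfolding d_def e_def using x y by (simp_all add: conj_eq_mult_commutator)
  have "inv y \<otimes> (x \<otimes> d) \<otimes> y = (inv y \<otimes> x \<otimes> y) \<otimes> (inv y \<otimes> d \<otimes> y)"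
    using x y c by (simp add: m_assoc inv_cancel_left)
  then have xyy: "inv y \<otimes> (inv y \<otimes> x \<otimes> y) \<otimes> y = x \<otimes> d \<otimes> (d \<otimes> e)"
    unfolding xy dy .
  have yx: "commutator G y x = inv d"
    unfolding d_def using x y by (simp add: inv_commutator)
  \<comment> \<open>The word splits as the conjugate of \<open>x\<close> by \<open>y^2\<close> times
    the conjugate of \<open>d\<close> by \<open>y\<close>.\<close>
  have "inv y [^] (2::nat) \<otimes> x \<otimes> y \<otimes> inv x \<otimes> inv y \<otimes> x \<otimes> y [^] (2::nat)
      = (inv y \<otimes> (inv y \<otimes> x \<otimes> y) \<otimes> y) \<otimes> (inv y \<otimes> d \<otimes> y)"
    unfolding d_def using x y by (simp add: numeral_2_eq_2 word_simps)
  also have "\<dots> = x \<otimes> (d \<otimes> d \<otimes> d) \<otimes> (e \<otimes> e)"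
    unfolding xyy dy using x c by (simp add: m_assoc ed' ed)
  finally have v: "inv y [^] (2::nat) \<otimes> x \<otimes> y \<otimes> inv x \<otimes> inv y \<otimes> x \<otimes> y [^] (2::nat)
      = x \<otimes> (d \<otimes> d \<otimes> d) \<otimes> (e \<otimes> e)" .
  have u: "x \<otimes> inv y \<otimes> inv x \<otimes> y \<otimes> x = x \<otimes> inv d"
    unfolding d_def using x y by (simp add: word_simps)
  have "inv e \<otimes> inv d = inv d \<otimes> inv e"
    using ed c by (metis inv_mult_group)
  then have edi: "inv e \<otimes> (inv d \<otimes> z) = inv d \<otimes> (inv e \<otimes> z)" if "z \<in> carrier G" for z
    using c that by (metis inv_closed m_assoc)
  show ?thesis
    unfolding G2_word_def v u yx e_def[symmetric] d_def[symmetric]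
    using x c by (simp add: numeral_eq_Suc m_assoc inv_mult_group edi)
qed

interpretation F2: group F2
  unfolding F2_def by (rule group_free_group)

lemma F2_gens_closed [simp, intro]: "x_F2 \<in> carrier F2" "y_F2 \<in> carrier F2"
  by (simp_all add: x_F2_def y_F2_def free_gen_def F2_def free_group_def)

lemma generate_F2: "generate F2 {x_F2, y_F2} = carrier F2"
proof -
  have "free_gen a \<in> {x_F2, y_F2}" for a
    by (cases a) (simp_all add: x_F2_def y_F2_def)
  then have "range free_gen = {x_F2, y_F2}" by (auto simp: x_F2_def y_F2_def)
  then show ?thesis using generate_free_group[of "UNIV :: gens set"] by (simp add: F2_def)
qed

lemma relators_G2_relation: "relators F2 G2_relation = {G2_word F2 x_F2 y_F2}"
  by (auto simp: relators_def G2_relation_def G2_word_def Let_def)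

lemma relators_class3_relation:
  "relators G (class3_relation G x y) =
    {commutator G y x [^]\<^bsub>G\<^esub> (4::nat)
      \<otimes>\<^bsub>G\<^esub> inv\<^bsub>G\<^esub> (commutator G (commutator G x y) y [^]\<^bsub>G\<^esub> (2::nat))}"
  by (auto simp: relators_def class3_relation_def)

section \<open>Affine groups\<close>

text \<open>The triple \<open>(a, u, v)\<close> is the affine map \<open>z \<mapsto> z u + a\<close>, composed from left to right. The last
  entry stores the inverse of the unit \<open>u\<close>, and \<open>u\<close> is required to be 1 modulo \<open>d\<close> so that each
  commutator gains a factor \<open>d\<close>.\<close>

definition affine_group :: "'a::comm_ring_1 \<Rightarrow> ('a \<times> 'a \<times> 'a) monoid" where
  "affine_group d =
     \<lparr>carrier = {(a, u, v). u * v = 1 \<and> d dvd u - 1},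
      monoid.mult = (\<lambda>(a, u, v) (b, u', v'). (a * u' + b, u * u', v * v')),
      one = (0, 1, 1)\<rparr>"

definition translations_by :: "'a::comm_ring_1 set \<Rightarrow> ('a \<times> 'a \<times> 'a) set" where
  "translations_by I = {(a, 1, 1) | a. a \<in> I}"

lemma affine_group_simps:
  "(a, u, v) \<in> carrier (affine_group d) \<longleftrightarrow> u * v = 1 \<and> d dvd u - 1"
  "(a, u, v) \<otimes>\<^bsub>affine_group d\<^esub> (b, u', v') = (a * u' + b, u * u', v * v')"
  "\<one>\<^bsub>affine_group d\<^esub> = (0, 1, 1)"
  by (simp_all add: affine_group_def)

lemma group_affine_group: "group (affine_group d)"
proof (rule groupI)
  have dvd: "d dvd u * u' - 1" if "d dvd u - 1" "d dvd u' - 1" for u u'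
  proof -
    have "d dvd (u - 1) * u' + (u' - 1)" using that by (intro dvd_add dvd_mult2)
    then show ?thesis by (simp add: algebra_simps)
  qed
  fix p q r assume p: "p \<in> carrier (affine_group d)"
  obtain a u v where p_eq: "p = (a, u, v)" by (cases p)
  then have uv: "u * v = 1" "d dvd u - 1" using p by (simp_all add: affine_group_simps)
  {
    assume q: "q \<in> carrier (affine_group d)"
    obtain b u' v' where q_eq: "q = (b, u', v')" by (cases q)
    then have "u' * v' = 1" "d dvd u' - 1" using q by (simp_all add: affine_group_simps)
    moreover have "u * u' * (v * v') = (u * v) * (u' * v')" by (simp add: algebra_simps)
    ultimately show "p \<otimes>\<^bsub>affine_group d\<^esub> q \<in> carrier (affine_group d)"
      using p_eq q_eq uv dvd by (simp add: affine_group_simps)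
  next
    show "p \<otimes>\<^bsub>affine_group d\<^esub> q \<otimes>\<^bsub>affine_group d\<^esub> r
        = p \<otimes>\<^bsub>affine_group d\<^esub> (q \<otimes>\<^bsub>affine_group d\<^esub> r)"
      by (cases p; cases q; cases r) (simp add: affine_group_simps algebra_simps)
  next
    show "\<one>\<^bsub>affine_group d\<^esub> \<otimes>\<^bsub>affine_group d\<^esub> p = p"
      using p_eq by (simp add: affine_group_simps)
  next
    \<comment> \<open>The inverse unit is again 1 modulo \<open>d\<close>.\<close>
    have "v - 1 = - v * (u - 1)" using uv by (simp add: algebra_simps)
    then have "(- a * v, v, u) \<in> carrier (affine_group d)"
      using uv by (simp add: affine_group_simps mult.commute)
    moreover have "(- a * v, v, u) \<otimes>\<^bsub>affine_group d\<^esub> p = \<one>\<^bsub>affine_group d\<^esub>"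
      using uv p_eq by (simp add: affine_group_simps algebra_simps)
    ultimately show "\<exists>q\<in>carrier (affine_group d). q \<otimes>\<^bsub>affine_group d\<^esub> p = \<one>\<^bsub>affine_group d\<^esub>"
      by blast
  }
qed (simp add: affine_group_simps)

lemma inv_affine_group:
  assumes "u * v = 1" "d dvd u - 1"
  shows "inv\<^bsub>affine_group d\<^esub> (a, u, v) = (- a * v, v, u)"
proof -
  interpret group "affine_group d" by (rule group_affine_group)
  have "v - 1 = - v * (u - 1)" using assms by (simp add: algebra_simps)
  then have "(- a * v, v, u) \<in> carrier (affine_group d)"
    using assms by (simp add: affine_group_simps mult.commute)
  then show ?thesis
    using assms by (intro inv_equality) (simp_all add: affine_group_simps algebra_simps)
qed

text \<open>Conjugating a translation by an affine map scales its vector by a unit, so an ideal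
  \<open>I\<close> gives a normal subgroup.\<close>

lemma translations_by_normal:
  assumes "0 \<in> I" "\<And>a b. a \<in> I \<Longrightarrow> b \<in> I \<Longrightarrow> a + b \<in> I" "\<And>r a. a \<in> I \<Longrightarrow> r * a \<in> I"
  shows "translations_by I \<lhd> affine_group d"
proof -
  interpret group "affine_group d" by (rule group_affine_group)
  have neg: "- a \<in> I" if "a \<in> I" for a
    using assms(3)[OF that, of "- 1"] by simp
  show ?thesis
  proof (rule normal_invI)
    show "subgroup (translations_by I) (affine_group d)"
      by (rule subgroupI)
        (use assms neg in \<open>auto simp: translations_by_def affine_group_simps inv_affine_group\<close>)
  next
    fix g h assume g: "g \<in> carrier (affine_group d)" and h: "h \<in> translations_by I"
    obtain a where a: "h = (a, 1, 1)" "a \<in> I" using h by (auto simp: translations_by_def)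
    obtain b u v where b: "g = (b, u, v)" by (cases g)
    then have uv: "u * v = 1" "d dvd u - 1" using g by (simp_all add: affine_group_simps)
    have "g \<otimes>\<^bsub>affine_group d\<^esub> h \<otimes>\<^bsub>affine_group d\<^esub> inv\<^bsub>affine_group d\<^esub> g = (v * a, 1, 1)"
      unfolding a b using uv
      by (simp add: affine_group_simps inv_affine_group mult.commute) (simp add: algebra_simps)
    then show "g \<otimes>\<^bsub>affine_group d\<^esub> h \<otimes>\<^bsub>affine_group d\<^esub> inv\<^bsub>affine_group d\<^esub> g \<in> translations_by I"
      using assms(3) a by (auto simp: translations_by_def)
  qed
qed

text \<open>The linear parts commute, so a commutator is a translation. Against a map with
  \<open>b = 0\<close>, translation by \<open>a\<close> becomes translation by
  \<open>a (u' - 1)\<close>.\<close>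

lemma commutator_affine_group:
  assumes "u * v = 1" "d dvd u - 1" "u' * v' = 1" "d dvd u' - 1"
  shows "commutator (affine_group d) (a, u, v) (b, u', v') = (a * (u' - 1) - b * (u - 1), 1, 1)"
proof -
  have e: "v * u = 1" "v' * u' = 1" using assms by (simp_all add: mult.commute)
  have c: "v * (u * w) = w" "v' * (u' * w) = w" "u * (v * w) = w" "u' * (v' * w) = w" for w
    using e assms by (simp_all flip: mult.assoc)
  have "u * (u' * (v * v')) = (u * v) * (u' * v')" by (simp add: mult_ac)
  then have "u * (u' * (v * v')) = 1" using assms by simp
  then show ?thesis
    using assms e c
    by (simp add: commutator_def inv_affine_group affine_group_simps ring_distribs mult_ac)
qed

text \<open>The induction starts at gamma_2, the first term consisting of translations, whose
  vectors carry one factor \<open>d\<close>; each further commutator multiplies by some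
  \<open>u - 1\<close>.\<close>

lemma lower_central_affine_group:
  "lower_central (Suc (Suc k)) (affine_group d) \<subseteq> translations_by {a. d ^ Suc k dvd a}"
proof (induction k)
  interpret group "affine_group d" by (rule group_affine_group)
  have sub: "subgroup (translations_by {a. c dvd a}) (affine_group d)" for c
    by (intro normal_imp_subgroup translations_by_normal) auto
  {
    case 0
    have "commutator (affine_group d) p q \<in> translations_by {a. d ^ Suc 0 dvd a}"
      if pq: "p \<in> carrier (affine_group d)" "q \<in> carrier (affine_group d)" for p q
    proof -
      obtain a u v where p: "p = (a, u, v)" by (cases p)
      obtain b u' v' where q: "q = (b, u', v')" by (cases q)
      have "d dvd a * (u' - 1) - b * (u - 1)"
        using pq unfolding p q affine_group_simps by (metis dvd_diff dvd_mult)
      then show ?thesis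
        using pq unfolding p q affine_group_simps
        by (auto simp: commutator_affine_group translations_by_def)
    qed
    then show ?case
      unfolding lower_central.simps by (intro generate_subgroup_incl sub) auto
  next
    case (Suc k)
    have "commutator (affine_group d) p q \<in> translations_by {a. d ^ Suc (Suc k) dvd a}"
      if p: "p \<in> lower_central (Suc (Suc k)) (affine_group d)" and q: "q \<in> carrier (affine_group d)"
      for p q
    proof -
      obtain a where a: "p = (a, 1, 1)" "d ^ Suc k dvd a"
        using p Suc.IH by (auto simp: translations_by_def simp del: lower_central.simps)
      obtain b u v where b: "q = (b, u, v)" by (cases q)
      then have uv: "u * v = 1" "d dvd u - 1" using q by (simp_all add: affine_group_simps)
      have "d ^ Suc k * d dvd a * (u - 1)"
        using a uv by (intro mult_dvd_mono)
      then show ?thesis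
        using uv unfolding a b by (simp add: commutator_affine_group translations_by_def mult.commute)
    qed
    then show ?case
      unfolding lower_central.simps(3)[of "Suc k"] by (intro generate_subgroup_incl sub) auto
  }
qed

text \<open>With \<open>x\<close> the translation by 1 and \<open>y\<close> the multiplication by
  \<open>t\<close>, the two sides of the relation are translations by \<open>2 - t\<close> and
  \<open>t (2 t - 1)\<close>; the relator is their difference.\<close>

lemma G2_word_affine_group:
  assumes "t * t' = 1" "d dvd t - 1"
  shows "G2_word (affine_group d) (1, 1, 1) (0, t, t') = (2 - 2 * t\<^sup>2, 1, 1)"
proof -
  interpret group "affine_group d" by (rule group_affine_group)
  have e: "t' * t = 1" using assms by (simp add: mult.commute)
  have c: "t' * (t * w) = w" "t * (t' * w) = w" for w
    using e assms by (simp_all flip: mult.assoc)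
  have "inv\<^bsub>affine_group d\<^esub> (t * (2 * t - 1), 1, 1) = (- (t * (2 * t - 1)), 1, 1)"
    by (simp add: inv_affine_group)
  moreover have "inv\<^bsub>affine_group d\<^esub> (0, t, t') [^]\<^bsub>affine_group d\<^esub> (2::nat) \<otimes>\<^bsub>affine_group d\<^esub> (1, 1, 1)
      \<otimes>\<^bsub>affine_group d\<^esub> (0, t, t') \<otimes>\<^bsub>affine_group d\<^esub> inv\<^bsub>affine_group d\<^esub> (1, 1, 1)
      \<otimes>\<^bsub>affine_group d\<^esub> inv\<^bsub>affine_group d\<^esub> (0, t, t') \<otimes>\<^bsub>affine_group d\<^esub> (1, 1, 1)
      \<otimes>\<^bsub>affine_group d\<^esub> (0, t, t') [^]\<^bsub>affine_group d\<^esub> (2::nat) = (t * (2 * t - 1), 1, 1)"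
    using assms e c
    by (simp add: inv_affine_group affine_group_simps numeral_2_eq_2 ring_distribs mult_ac)
  ultimately show ?thesis
    unfolding G2_word_def using assms e c
    by (simp add: inv_affine_group affine_group_simps power2_eq_square ring_distribs mult_ac)
qed

section \<open>Integral power series in one variable\<close>

text \<open>The alternating geometric series makes \<open>1 + fps_X\<close> a unit, as the linear
  part of an affine map has to be; this is why power series replace polynomials.\<close>

lemma fps_one_plus_X_unit:
  "(1 + fps_X) * Abs_fps (\<lambda>n. (- 1) ^ n) = (1 :: 'a::comm_ring_1 fps)"
proof (rule fps_ext)
  fix n
  show "fps_nth ((1 + fps_X) * Abs_fps (\<lambda>n. (- 1) ^ n)) n = fps_nth (1 :: 'a fps) n"
    by (cases n) (simp_all add: distrib_right)
qed

text \<open>Comparing coefficients forces \<open>g\<close> to vanish below degree \<open>k - 1\<close>, and then \<open>2 = 4 g\<^sub>k\<^sub>-\<^sub>1\<close>.\<close>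

lemma two_X_power_notin_ideal:
  fixes g h :: "int fps"
  assumes "k > 0"
  shows "2 * fps_X ^ k \<noteq> 2 * fps_X * (fps_X + 2) * g + fps_X ^ Suc k * h"
proof
  assume eq: "2 * fps_X ^ k = 2 * fps_X * (fps_X + 2) * g + fps_X ^ Suc k * h"
  have "2 * fps_X * (fps_X + 2) * g = fps_X * (fps_const 2 * (fps_X * g) + fps_const 4 * g)"
    by (simp add: algebra_simps flip: numeral_fps_const)
  then have eq': "fps_const 2 * fps_X ^ k =
      fps_X * (fps_const 2 * (fps_X * g) + fps_const 4 * g) + fps_X ^ Suc k * h"
    using eq by (simp add: numeral_fps_const)
  \<comment> \<open>The cases 0 and 1 guard the truncated subtractions in the indices; the term with
    \<open>h\<close> contributes nothing up to degree \<open>k\<close>.\<close>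
  have c: "(if i = k then 2 else 0) =
      (if i = 0 then 0 else 2 * (if i = 1 then 0 else fps_nth g (i - 2)) + 4 * fps_nth g (i - 1))"
    if "i \<le> k" for i
  proof -
    have "fps_nth (fps_X ^ Suc k * h) i = 0"
      using that by (simp only: fps_X_power_mult_nth) simp
    moreover have "fps_nth (fps_X * f) i = (if i = 0 then 0 else fps_nth f (i - 1))" for f :: "int fps"
      by simp
    ultimately show ?thesis
      using arg_cong[OF eq', of "\<lambda>f. fps_nth f i"]
      by (auto simp: numeral_2_eq_2 simp del: power_Suc split: if_splits)
  qed
  have "fps_nth g i = 0" if "Suc i < k" for i
    using that
  proof (induction i rule: less_induct)
    case (less i)
    then show ?case using c[of "Suc i"] by (cases i) auto
  qed
  then have "2 = 4 * fps_nth g (k - 1)" using c[of k] assms by (cases "k = 1") auto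
  then show False by presburger
qed

section \<open>The lower central factors of \<open>G\<^sub>2\<close>\<close>

interpretation G2: group G2
  unfolding G2_def
  by (intro group_hom.axioms(2)[OF impose_class_hom(1)] F2.is_group) (simp add: relators_G2_relation)

interpretation F2_G2: group_hom F2 G2 "impose_class F2 G2_relation"
  unfolding G2_def by (intro impose_class_hom F2.is_group) (simp add: relators_G2_relation)

lemma surj_F2_G2: "impose_class F2 G2_relation ` carrier F2 = carrier G2"
  unfolding G2_def by (intro impose_class_hom F2.is_group) (simp add: relators_G2_relation)

lemma kernel_F2_G2:
  "kernel F2 G2 (impose_class F2 G2_relation) = normal_closure F2 {G2_word F2 x_F2 y_F2}"
  unfolding G2_def relators_G2_relation[symmetric]
  by (intro impose_class_hom F2.is_group) (simp add: relators_G2_relation)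

lemma G2_gens_closed [simp, intro]: "x_G2 \<in> carrier G2" "y_G2 \<in> carrier G2"
  by (simp_all add: x_G2_def y_G2_def)

lemma generate_G2: "generate G2 {x_G2, y_G2} = carrier G2"
proof -
  have "generate G2 (impose_class F2 G2_relation ` {x_F2, y_F2}) = carrier G2"
    using F2_G2.generate_img[of "{x_F2, y_F2}"] unfolding generate_F2 surj_F2_G2 by simp
  then show ?thesis unfolding x_G2_def y_G2_def by simp
qed

lemma G2_word_G2: "G2_word G2 x_G2 y_G2 = \<one>\<^bsub>G2\<^esub>"
proof -
  have "G2_word F2 x_F2 y_F2 \<in> kernel F2 G2 (impose_class F2 G2_relation)"
    unfolding kernel_F2_G2 using normal_closure_superset[of "{G2_word F2 x_F2 y_F2}" F2] by simp
  then show ?thesis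
    by (simp add: kernel_def F2_G2.hom_G2_word x_G2_def y_G2_def)
qed

text \<open>Modulo gamma_3 the element \<open>e\<close> is trivial, hence central, and the relator
  becomes a conjugate of the fourth power of \<open>[y, x]\<close>.\<close>

lemma commutator_pow4_G2: "commutator G2 y_G2 x_G2 [^]\<^bsub>G2\<^esub> (4::nat) \<in> lower_central 3 G2"
proof -
  let ?N = "lower_central 3 G2"
  let ?H = "G2 Mod ?N"
  interpret N: normal ?N G2 by (rule G2.lower_central_normal)
  interpret p: group_hom G2 ?H "\<lambda>a. ?N #>\<^bsub>G2\<^esub> a" by (rule N.group_hom_Mod)
  let ?x = "?N #>\<^bsub>G2\<^esub> x_G2" and ?y = "?N #>\<^bsub>G2\<^esub> y_G2"
  have xy: "?x \<in> carrier ?H" "?y \<in> carrier ?H" by (rule p.hom_closed; simp)+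
  have "commutator ?H (commutator ?H ?x ?y) ?y \<in> lower_central (Suc (Suc (Suc 0))) ?H"
    using xy by (intro p.H.commutator_lower_central) simp_all
  then have e: "commutator ?H (commutator ?H ?x ?y) ?y = \<one>\<^bsub>?H\<^esub>"
    using G2.lower_central_Mod_trivial[of 3] by (simp add: numeral_3_eq_3 del: lower_central.simps)
  let ?c = "commutator ?H ?y ?x"
  have "\<one>\<^bsub>?H\<^esub> = G2_word ?H ?x ?y"
    using p.hom_G2_word[of x_G2 y_G2] G2_word_G2 p.hom_one by (metis G2_gens_closed)
  also have "\<dots> = ?x \<otimes>\<^bsub>?H\<^esub> ?c [^]\<^bsub>?H\<^esub> (4::nat) \<otimes>\<^bsub>?H\<^esub> inv\<^bsub>?H\<^esub> ?x"
    using xy by (subst p.H.G2_word_class3) (simp_all add: e del: one_FactGroup mult_FactGroup)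
  finally have "?c [^]\<^bsub>?H\<^esub> (4::nat) = \<one>\<^bsub>?H\<^esub>"
    using xy p.H.conj_eq_one_iff[of "?c [^]\<^bsub>?H\<^esub> (4::nat)" ?x] by simp
  moreover have "?c [^]\<^bsub>?H\<^esub> (4::nat) = ?N #>\<^bsub>G2\<^esub> (commutator G2 y_G2 x_G2 [^]\<^bsub>G2\<^esub> (4::nat))"
    by (simp add: p.hom_nat_pow p.hom_commutator)
  ultimately show ?thesis
    using N.Mod_eq_one_iff by simp
qed

section \<open>Elements of order 4 in every factor\<close>

text \<open>The preimage \<open>K\<close> in \<open>F2\<close> of the translations by the ideal
  \<open>I\<close> contains the relator and gamma_(j+2). If the square of \<open>w\<close> had
  weight \<open>j + 2\<close>, then \<open>2 s^j\<close> would lie in \<open>I\<close>.\<close>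

lemma commutator_notin_lower_central_G2:
  fixes j :: nat
  assumes "j > 0"
  defines "w \<equiv> ((\<lambda>z. commutator G2 z y_G2) ^^ j) x_G2"
  shows "w \<in> lower_central (Suc j) G2" and "w [^]\<^bsub>G2\<^esub> (2::nat) \<notin> lower_central (Suc (Suc j)) G2"
proof -
  define s t t' :: "int fps" where "s = fps_X" and "t = 1 + fps_X" and "t' = Abs_fps (\<lambda>n. (- 1) ^ n)"
  have t: "t * t' = 1" "s dvd t - 1"
    unfolding t_def t'_def s_def by (simp_all add: fps_one_plus_X_unit)
  define M where "M = affine_group s"
  interpret M: group M unfolding M_def by (rule group_affine_group)
  define \<phi> where "\<phi> = free_lift M (\<lambda>g. if g = GX then (1, 1, 1) else (0, t, t'))"
  have gens: "(1, 1, 1) \<in> carrier M" "(0, t, t') \<in> carrier M"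
    using t by (simp_all add: M_def affine_group_simps)
  interpret \<phi>: group_hom F2 M \<phi>
    unfolding F2_def \<phi>_def using gens by (intro group_hom_free_lift M.is_group) auto
  have \<phi>_gens: "\<phi> x_F2 = (1, 1, 1)" "\<phi> y_F2 = (0, t, t')"
    unfolding \<phi>_def x_F2_def y_F2_def using gens
    by (simp_all add: free_lift_free_gen[OF M.is_group])
  \<comment> \<open>The first generator is the translation vector of the relator up to sign; the
    second absorbs gamma_(j+2).\<close>
  define I where "I = {f. \<exists>g h. f = 2 * s * (s + 2) * g + s ^ Suc j * h}"
  have I: "translations_by I \<lhd> M"
    unfolding M_def
  proof (rule translations_by_normal)
    show "0 \<in> I" unfolding I_def by (auto intro!: exI[of _ 0])
    show "a + b \<in> I" if ab: "a \<in> I" "b \<in> I" for a b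
    proof -
      obtain g h where a: "a = 2 * s * (s + 2) * g + s ^ Suc j * h" using ab by (auto simp: I_def)
      obtain g' h' where b: "b = 2 * s * (s + 2) * g' + s ^ Suc j * h'" using ab by (auto simp: I_def)
      have "a + b = 2 * s * (s + 2) * (g + g') + s ^ Suc j * (h + h')"
        unfolding a b by (simp add: algebra_simps)
      then show ?thesis unfolding I_def by blast
    qed
    show "r * a \<in> I" if a: "a \<in> I" for r a
    proof -
      obtain g h where a: "a = 2 * s * (s + 2) * g + s ^ Suc j * h" using a by (auto simp: I_def)
      have "r * a = 2 * s * (s + 2) * (r * g) + s ^ Suc j * (r * h)"
        unfolding a by (simp add: algebra_simps)
      then show ?thesis unfolding I_def by blast
    qed
  qed
  define K where "K = {a \<in> carrier F2. \<phi> a \<in> translations_by I}"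
  interpret K: normal K F2 unfolding K_def using I by (rule \<phi>.normal_vimage)
  have "2 - 2 * t\<^sup>2 = 2 * s * (s + 2) * (- 1) + s ^ Suc j * 0"
    by (simp add: t_def s_def power2_eq_square algebra_simps)
  then have "2 - 2 * t\<^sup>2 \<in> I" unfolding I_def by blast
  then have "G2_word F2 x_F2 y_F2 \<in> K"
    unfolding K_def using t
    by (simp add: \<phi>.hom_G2_word \<phi>_gens M_def G2_word_affine_group translations_by_def)
  then have ker: "kernel F2 G2 (impose_class F2 G2_relation) \<subseteq> K"
    unfolding kernel_F2_G2 by (intro normal_closure_minimal K.normal_axioms) simp
  have "\<phi> ` lower_central (Suc (Suc j)) F2 \<subseteq> lower_central (Suc (Suc j)) M"
    by (rule \<phi>.lower_central_img_subset)
  also have "\<dots> \<subseteq> translations_by {a. s ^ Suc j dvd a}"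
    unfolding M_def by (rule lower_central_affine_group)
  also have "\<dots> \<subseteq> translations_by I"
  proof -
    have "a \<in> I" if "s ^ Suc j dvd a" for a
    proof -
      obtain h where "a = s ^ Suc j * h" using \<open>s ^ Suc j dvd a\<close> by (rule dvdE)
      then have "a = 2 * s * (s + 2) * 0 + s ^ Suc j * h" by simp
      then show ?thesis unfolding I_def by blast
    qed
    then show ?thesis by (auto simp: translations_by_def simp del: power_Suc)
  qed
  finally have lc: "lower_central (Suc (Suc j)) F2 \<subseteq> K"
    unfolding K_def using F2.lower_central_in_carrier by blast
  \<comment> \<open>\<open>w\<close> is lifted to the free group, where \<open>\<phi>\<close> is
    defined.\<close>
  define v where "v = (\<lambda>i. ((\<lambda>z. commutator F2 z y_F2) ^^ i) x_F2)"
  have v: "v i \<in> lower_central (Suc i) F2" for i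
    unfolding v_def using F2.commutator_lower_central by (induction i) (simp_all del: lower_central.simps(3))
  then have v_closed: "v i \<in> carrier F2" for i
    using F2.lower_central_in_carrier by blast
  have \<phi>_v: "\<phi> (v i) = (s ^ i, 1, 1)" for i
  proof (induction i)
    case (Suc i)
    have "v (Suc i) = commutator F2 (v i) y_F2" by (simp add: v_def)
    then show ?case
      using Suc v_closed t
      by (simp add: \<phi>.hom_commutator \<phi>_gens M_def commutator_affine_group) (simp add: t_def s_def mult.commute)
  qed (simp add: v_def \<phi>_gens)
  have "impose_class F2 G2_relation (v i) = ((\<lambda>z. commutator G2 z y_G2) ^^ i) x_G2" for i
  proof (induction i)
    case (Suc i)
    have "v (Suc i) = commutator F2 (v i) y_F2" by (simp add: v_def)
    then show ?case
      using Suc v_closed by (simp add: F2_G2.hom_commutator y_G2_def)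
  qed (simp add: v_def x_G2_def)
  then have w: "w = impose_class F2 G2_relation (v j)" by (simp add: w_def)
  show "w \<in> lower_central (Suc j) G2"
    using v[of j] F2_G2.lower_central_img_subset unfolding w by blast
  show "w [^]\<^bsub>G2\<^esub> (2::nat) \<notin> lower_central (Suc (Suc j)) G2"
  proof
    assume "w [^]\<^bsub>G2\<^esub> (2::nat) \<in> lower_central (Suc (Suc j)) G2"
    \<comment> \<open>Since gamma_(j+2) of \<open>G2\<close> is the image of that of
      \<open>F2\<close>, the square of the lift differs from some \<open>b\<close> in gamma_(j+2) of
      \<open>F2\<close> by an element of the kernel, and both lie in \<open>K\<close>.\<close>
    then have "impose_class F2 G2_relation (v j [^]\<^bsub>F2\<^esub> (2::nat))
        \<in> impose_class F2 G2_relation ` lower_central (Suc (Suc j)) F2"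
      unfolding F2_G2.lower_central_img[OF surj_F2_G2] w
      using v_closed by (simp add: F2_G2.hom_nat_pow)
    then obtain b where b: "b \<in> lower_central (Suc (Suc j)) F2"
      "impose_class F2 G2_relation (v j [^]\<^bsub>F2\<^esub> (2::nat)) = impose_class F2 G2_relation b"
      by blast
    have bc: "b \<in> carrier F2" using b F2.lower_central_in_carrier by blast
    have "v j [^]\<^bsub>F2\<^esub> (2::nat) \<otimes>\<^bsub>F2\<^esub> inv\<^bsub>F2\<^esub> b \<in> kernel F2 G2 (impose_class F2 G2_relation)"
      using b(2) bc v_closed by (simp add: kernel_def)
    then have "v j [^]\<^bsub>F2\<^esub> (2::nat) \<otimes>\<^bsub>F2\<^esub> inv\<^bsub>F2\<^esub> b \<otimes>\<^bsub>F2\<^esub> b \<in> K"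
      using ker lc b(1) by - (rule K.m_closed, auto simp del: lower_central.simps)
    then have "v j [^]\<^bsub>F2\<^esub> (2::nat) \<in> K"
      using bc v_closed by (simp add: F2.m_assoc)
    then have "\<phi> (v j) [^]\<^bsub>M\<^esub> (2::nat) \<in> translations_by I"
      unfolding K_def using v_closed by (simp add: \<phi>.hom_nat_pow)
    moreover have "\<phi> (v j) [^]\<^bsub>M\<^esub> (2::nat) = \<phi> (v j) \<otimes>\<^bsub>M\<^esub> \<phi> (v j)"
      using v_closed by (simp add: numeral_2_eq_2)
    moreover have "\<dots> = (2 * s ^ j, 1, 1)"
      unfolding \<phi>_v M_def by (simp add: affine_group_simps)
    ultimately have "2 * s ^ j \<in> I"
      by (simp add: translations_by_def)
    then show False
      using two_X_power_notin_ideal[OF \<open>j > 0\<close>] unfolding I_def s_def by blast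
  qed
qed

text \<open>Of the four commutators of the generators two are trivial and the other two are mutually
  inverse.\<close>

lemma lower_central_2_G2_generate:
  "lower_central 2 G2 \<subseteq> generate G2 ({commutator G2 y_G2 x_G2} \<union> lower_central (Suc 2) G2)"
proof -
  let ?c = "commutator G2 y_G2 x_G2"
  let ?T = "{commutator G2 s y | s y. s \<in> {x_G2, y_G2} \<and> y \<in> {x_G2, y_G2}}"
  let ?L = "generate G2 ({?c} \<union> lower_central (Suc 2) G2)"
  have L: "subgroup ?L G2"
    by (intro G2.generate_is_subgroup) (use G2.lower_central_in_carrier in auto)
  have "lower_central (Suc (Suc 0)) G2 \<subseteq> generate G2 (?T \<union> lower_central (Suc (Suc (Suc 0))) G2)"
  proof (rule G2.lower_central_Suc_generate)
    show "lower_central (Suc 0) G2 \<subseteq> generate G2 ({x_G2, y_G2} \<union> lower_central (Suc (Suc 0)) G2)"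
      using generate_G2 G2.mono_generate[of "{x_G2, y_G2}"] by simp
  qed (use generate_G2 in auto)
  also have "\<dots> \<subseteq> ?L"
  proof (rule G2.generate_subgroup_incl[OF _ L])
    have c: "?c \<in> ?L" by (intro generate.incl) simp
    have "commutator G2 x_G2 y_G2 = inv\<^bsub>G2\<^esub> ?c"
      by (simp add: G2.inv_commutator)
    then have "commutator G2 x_G2 y_G2 \<in> ?L"
      using subgroup.m_inv_closed[OF L c] by simp
    then have "?T \<subseteq> ?L"
      using c subgroup.one_closed[OF L] by auto
    moreover have "lower_central (Suc (Suc (Suc 0))) G2 \<subseteq> ?L"
      by (auto intro!: generate.incl simp: numeral_2_eq_2 simp del: lower_central.simps)
    ultimately show "?T \<union> lower_central (Suc (Suc (Suc 0))) G2 \<subseteq> ?L"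
      by simp
  qed
  finally show ?thesis by (simp add: numeral_2_eq_2)
qed

lemma commutator_in_lower_central_2_G2: "commutator G2 y_G2 x_G2 \<in> lower_central 2 G2"
  using G2.commutator_lower_central[of y_G2 "Suc 0" x_G2] by (simp add: numeral_2_eq_2)

lemma lower_central_G2_torsion_generators:
  assumes "k \<ge> 2"
  shows "\<exists>S. finite S \<and> S \<subseteq> lower_central k G2
    \<and> lower_central k G2 \<subseteq> generate G2 (S \<union> lower_central (Suc k) G2)
    \<and> (\<forall>s\<in>S. s [^]\<^bsub>G2\<^esub> (4::nat) \<in> lower_central (Suc k) G2)"
proof (rule G2.lower_central_torsion_generators[OF _ _ lower_central_2_G2_generate _ _ _ generate_G2 _ assms])
  show "s [^]\<^bsub>G2\<^esub> (4::nat) \<in> lower_central (Suc 2) G2" if "s \<in> {commutator G2 y_G2 x_G2}" for s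
    using that commutator_pow4_G2 by (simp add: numeral_3_eq_3 numeral_2_eq_2 del: lower_central.simps)
qed (use commutator_in_lower_central_2_G2 in auto)

lemma lower_central_factor_G2:
  assumes "k \<ge> 2"
  shows "finite (carrier (lower_central_factor k G2))"
    and "q \<in> carrier (lower_central_factor k G2) \<Longrightarrow> q [^]\<^bsub>lower_central_factor k G2\<^esub> (4::nat) = \<one>\<^bsub>lower_central_factor k G2\<^esub>"
    and "\<exists>q\<in>carrier (lower_central_factor k G2). group.ord (lower_central_factor k G2) q = 4"
proof -
  let ?Q = "lower_central_factor k G2"
  let ?cls = "\<lambda>a. lower_central (Suc k) G2 #>\<^bsub>G2\<^esub> a"
  interpret Q: comm_group ?Q by (rule G2.comm_group_lower_central_factor)
  obtain S where S: "finite S" "S \<subseteq> lower_central k G2"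
      "lower_central k G2 \<subseteq> generate G2 (S \<union> lower_central (Suc k) G2)"
      "\<And>s. s \<in> S \<Longrightarrow> s [^]\<^bsub>G2\<^esub> (4::nat) \<in> lower_central (Suc k) G2"
    using lower_central_G2_torsion_generators[OF assms] by blast
  have carrier: "carrier ?Q = generate ?Q (?cls ` S)"
    using S by (intro G2.generate_lower_central_factor)
  have sub: "?cls ` S \<subseteq> carrier ?Q"
    using S unfolding G2.carrier_lower_central_factor by blast
  have tors: "q [^]\<^bsub>?Q\<^esub> (4::nat) = \<one>\<^bsub>?Q\<^esub>" if q: "q \<in> ?cls ` S" for q
  proof -
    obtain s where s: "s \<in> S" "q = ?cls s" using q by blast
    then have "s \<in> lower_central k G2" using S by blast
    then have "q [^]\<^bsub>?Q\<^esub> (4::nat) = ?cls (s [^]\<^bsub>G2\<^esub> (4::nat))"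
      unfolding s by (rule G2.factor_class_pow)
    also have "\<dots> = \<one>\<^bsub>?Q\<^esub>"
      using S(4)[OF s(1)] G2.factor_class_eq_one_iff G2.lower_central_in_carrier by blast
    finally show ?thesis .
  qed
  show "finite (carrier ?Q)"
    unfolding carrier by (rule Q.finite_generate_torsion[OF _ sub tors]) (use S in simp_all)
  show pow4: "q [^]\<^bsub>?Q\<^esub> (4::nat) = \<one>\<^bsub>?Q\<^esub>" if "q \<in> carrier ?Q" for q
    by (rule Q.generate_torsion[OF sub tors]) (use that carrier in simp_all)
  \<comment> \<open>A commutator \<open>[x, y, ..., y]\<close> with \<open>k - 1\<close> letters
    \<open>y\<close> has weight \<open>k\<close>.\<close>
  have k: "k = Suc (k - 1)" "k - 1 > 0" using assms by simp_all
  define w where "w = ((\<lambda>z. commutator G2 z y_G2) ^^ (k - 1)) x_G2"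
  have w: "w \<in> lower_central k G2" "w [^]\<^bsub>G2\<^esub> (2::nat) \<notin> lower_central (Suc k) G2"
    using commutator_notin_lower_central_G2[OF k(2)] k(1) unfolding w_def by simp_all
  then have "?cls w \<in> carrier ?Q"
    unfolding G2.carrier_lower_central_factor by blast
  moreover have "?cls w [^]\<^bsub>?Q\<^esub> (2::nat) \<noteq> \<one>\<^bsub>?Q\<^esub>"
    unfolding G2.factor_class_pow[OF w(1)]
    using w G2.lower_central_in_carrier by (subst G2.factor_class_eq_one_iff) auto
  ultimately show "\<exists>q\<in>carrier ?Q. Q.ord q = 4"
    using pow4 Q.ord_eq_4 by blast
qed

lemma lower_central_factor_2_G2: "lower_central_factor 2 G2 \<cong> integer_mod_group 4"
proof -
  let ?Q = "lower_central_factor 2 G2"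
  let ?c = "lower_central (Suc 2) G2 #>\<^bsub>G2\<^esub> commutator G2 y_G2 x_G2"
  interpret Q: comm_group ?Q by (rule G2.comm_group_lower_central_factor)
  have gen: "generate ?Q {?c} = carrier ?Q"
    using G2.generate_lower_central_factor[OF _ lower_central_2_G2_generate]
      commutator_in_lower_central_2_G2 by simp
  then have c: "?c \<in> carrier ?Q" using generate.incl[of ?c "{?c}" ?Q] by simp
  obtain q where q: "q \<in> carrier ?Q" "Q.ord q = 4"
    using lower_central_factor_G2(3)[of 2] by auto
  \<comment> \<open>The class \<open>?c\<close> generates the factor, so a power that kills it also
    kills \<open>q\<close>. As \<open>q\<close> has order 4, the square of \<open>?c\<close> is not
    trivial.\<close>
  have pow: "q [^]\<^bsub>?Q\<^esub> n = \<one>\<^bsub>?Q\<^esub>" if "?c [^]\<^bsub>?Q\<^esub> n = \<one>\<^bsub>?Q\<^esub>" for n :: nat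
    using Q.generate_torsion[of "{?c}" n q] that c q gen by simp
  have "Q.ord ?c = 4"
  proof (rule Q.ord_eq_4)
    show "?c [^]\<^bsub>?Q\<^esub> (4::nat) = \<one>\<^bsub>?Q\<^esub>"
      using lower_central_factor_G2(2) c by simp
    show "?c [^]\<^bsub>?Q\<^esub> (2::nat) \<noteq> \<one>\<^bsub>?Q\<^esub>"
      using pow[of 2] q Q.pow_eq_id[of q 2] by auto
  qed (rule c)
  then show ?thesis
    using c gen by (intro Q.cyclic_iso_integer_mod_group) simp_all
qed

section \<open>The quotient by gamma_4\<close>

text \<open>Both groups are images of \<open>F2\<close>, one dividing first by the relator and then
  by gamma_4, the other in the opposite order. In \<open>Q\<close> the relator is a conjugate of
  \<open>rel\<close>, so the two kernels agree.\<close>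

lemma G2_Mod_lower_central_4:
  fixes Q x y R
  defines "Q \<equiv> F2 Mod lower_central 4 F2"
  defines "x \<equiv> lower_central 4 F2 #>\<^bsub>F2\<^esub> x_F2"
  defines "y \<equiv> lower_central 4 F2 #>\<^bsub>F2\<^esub> y_F2"
  defines "R \<equiv> class3_relation Q x y"
  shows "\<exists>h \<in> iso (G2 Mod lower_central 4 G2) (impose Q R).
            h (lower_central 4 G2 #>\<^bsub>G2\<^esub> x_G2) = impose_class Q R x
          \<and> h (lower_central 4 G2 #>\<^bsub>G2\<^esub> y_G2) = impose_class Q R y"
proof -
  let ?F = "lower_central 4 F2" and ?G = "lower_central 4 G2"
  let ?pi = "impose_class F2 G2_relation"
  interpret FN: normal ?F F2 by (rule F2.lower_central_normal)
  interpret GN: normal ?G G2 by (rule G2.lower_central_normal)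
  interpret p: group_hom F2 Q "\<lambda>a. ?F #>\<^bsub>F2\<^esub> a"
    unfolding Q_def by (rule FN.group_hom_Mod)
  have p_surj: "(\<lambda>a. ?F #>\<^bsub>F2\<^esub> a) ` carrier F2 = carrier Q"
    unfolding Q_def by (simp add: carrier_FactGroup)
  interpret r: group_hom G2 "G2 Mod ?G" "\<lambda>a. ?G #>\<^bsub>G2\<^esub> a"
    by (rule GN.group_hom_Mod)
  have xy: "x \<in> carrier Q" "y \<in> carrier Q" unfolding x_def y_def by simp_all
  define e where "e = commutator Q (commutator Q x y) y"
  define rel where "rel = commutator Q y x [^]\<^bsub>Q\<^esub> (4::nat) \<otimes>\<^bsub>Q\<^esub> inv\<^bsub>Q\<^esub> (e [^]\<^bsub>Q\<^esub> (2::nat))"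
  have ec: "e \<in> carrier Q" and rel: "rel \<in> carrier Q"
    unfolding rel_def e_def using xy by simp_all
  have R: "relators Q R = {rel}"
    unfolding R_def relators_class3_relation rel_def e_def ..
  interpret q: group_hom Q "impose Q R" "impose_class Q R"
    using impose_class_hom(1)[OF p.H.is_group] R rel by simp
  have q_surj: "impose_class Q R ` carrier Q = carrier (impose Q R)"
    and q_ker: "kernel Q (impose Q R) (impose_class Q R) = normal_closure Q {rel}"
    using impose_class_hom(2,3)[OF p.H.is_group, of R] R rel by simp_all
  \<comment> \<open>\<open>e\<close> has weight 3 and gamma_4 of \<open>Q\<close> is trivial, so
    \<open>e\<close> is central in \<open>Q\<close>.\<close>
  have "e \<in> lower_central (Suc (Suc (Suc 0))) Q"
    unfolding e_def using xy by (intro p.H.commutator_lower_central) simp_all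
  then have "commutator Q e z \<in> lower_central 4 Q" if "z \<in> carrier Q" for z
    using p.H.commutator_lower_central[OF _ that, of e "Suc (Suc (Suc 0))"]
    by (simp add: numeral_eq_Suc del: lower_central.simps)
  then have "commutator Q e z = \<one>\<^bsub>Q\<^esub>" if "z \<in> carrier Q" for z
    using F2.lower_central_Mod_trivial[of 4] that unfolding Q_def by blast
  then have e_comm: "e \<otimes>\<^bsub>Q\<^esub> z = z \<otimes>\<^bsub>Q\<^esub> e" if "z \<in> carrier Q" for z
    using that ec by (simp add: p.H.commute_iff_commutator)
  have "G2_word Q x y = x \<otimes>\<^bsub>Q\<^esub> rel \<otimes>\<^bsub>Q\<^esub> inv\<^bsub>Q\<^esub> x"
    unfolding rel_def e_def
    by (rule p.H.G2_word_class3) (use xy e_comm in \<open>simp_all add: e_def\<close>)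
  then have p_word: "?F #>\<^bsub>F2\<^esub> G2_word F2 x_F2 y_F2 = x \<otimes>\<^bsub>Q\<^esub> rel \<otimes>\<^bsub>Q\<^esub> inv\<^bsub>Q\<^esub> x"
    by (simp add: p.hom_G2_word x_def y_def)
  define f where "f = (\<lambda>a. ?G #>\<^bsub>G2\<^esub> ?pi a)"
  define g where "g = (\<lambda>a. impose_class Q R (?F #>\<^bsub>F2\<^esub> a))"
  interpret f: group_hom F2 "G2 Mod ?G" f
    using hom_compose[OF F2_G2.homh r.homh] r.H.is_group F2.is_group
    by (simp add: group_hom_def group_hom_axioms_def f_def comp_def)
  interpret g: group_hom F2 "impose Q R" g
    using hom_compose[OF p.homh q.homh] q.H.is_group F2.is_group
    by (simp add: group_hom_def group_hom_axioms_def g_def comp_def)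
  have f_surj: "f ` carrier F2 = carrier (G2 Mod ?G)"
    unfolding f_def carrier_FactGroup surj_F2_G2[symmetric] by (simp add: image_image)
  have g_surj: "g ` carrier F2 = carrier (impose Q R)"
    unfolding g_def q_surj[symmetric] p_surj[symmetric] by (simp add: image_image)
  have f_ker: "a \<in> kernel F2 (G2 Mod ?G) f \<longleftrightarrow> a \<in> carrier F2 \<and> ?pi a \<in> ?G" for a
    unfolding kernel_def f_def mem_Collect_eq one_FactGroup
    using GN.Mod_eq_one_iff[of "?pi a"] F2_G2.hom_closed[of a] by blast
  have g_ker: "a \<in> kernel F2 (impose Q R) g \<longleftrightarrow> a \<in> carrier F2 \<and> ?F #>\<^bsub>F2\<^esub> a \<in> normal_closure Q {rel}" for a
    unfolding q_ker[symmetric] kernel_def g_def mem_Collect_eq using p.hom_closed[of a] by blast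
  interpret C: normal "normal_closure Q {rel}" Q
    using rel by (intro normal_normal_closure p.H.is_group) simp
  interpret Kf: normal "kernel F2 (G2 Mod ?G) f" F2 by (rule f.normal_kernel)
  interpret Kg: normal "kernel F2 (impose Q R) g" F2 by (rule g.normal_kernel)
  have "G2_word F2 x_F2 y_F2 \<in> kernel F2 (impose Q R) g"
    unfolding g_ker p_word using xy normal_closure_superset[of "{rel}" Q] C.inv_op_closed2 by simp
  then have pi_ker: "kernel F2 G2 ?pi \<subseteq> kernel F2 (impose Q R) g"
    unfolding kernel_F2_G2 by (intro normal_closure_minimal Kg.normal_axioms) simp
  have F_g: "?F \<subseteq> kernel F2 (impose Q R) g"
  proof
    fix a assume a: "a \<in> ?F"
    have "?F #>\<^bsub>F2\<^esub> a = \<one>\<^bsub>Q\<^esub>"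
      unfolding Q_def one_FactGroup using a by (rule FN.rcos_const[OF F2.is_group])
    then show "a \<in> kernel F2 (impose Q R) g"
      unfolding g_ker using a C.one_closed by simp
  qed
  have F_f: "?F \<subseteq> kernel F2 (G2 Mod ?G) f"
  proof
    fix a assume a: "a \<in> ?F"
    have "?pi a \<in> ?G"
      using F2_G2.lower_central_img_subset[of 4] a by (rule subsetD[OF _ imageI])
    then show "a \<in> kernel F2 (G2 Mod ?G) f"
      unfolding f_ker using a by simp
  qed
  have "kernel F2 (G2 Mod ?G) f = kernel F2 (impose Q R) g"
  proof (intro subset_antisym subsetI)
    \<comment> \<open>The image of \<open>a\<close> in \<open>G2\<close> lifts to some
      \<open>b\<close> in gamma_4 of \<open>F2\<close>; then \<open>a\<close> is an element of the
      kernel of \<open>?pi\<close> times \<open>b\<close>, and \<open>g\<close> kills both.\<close>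
    fix a assume a: "a \<in> kernel F2 (G2 Mod ?G) f"
    then have ac: "a \<in> carrier F2" and "?pi a \<in> ?pi ` ?F"
      unfolding f_ker F2_G2.lower_central_img[OF surj_F2_G2] by simp_all
    then obtain b where b: "b \<in> ?F" "?pi a = ?pi b" by blast
    have bc: "b \<in> carrier F2" using b by simp
    have "?pi (a \<otimes>\<^bsub>F2\<^esub> inv\<^bsub>F2\<^esub> b) = ?pi b \<otimes>\<^bsub>G2\<^esub> inv\<^bsub>G2\<^esub> ?pi b"
      using ac bc unfolding b(2)[symmetric] by (simp only: F2_G2.hom_mult F2_G2.hom_inv F2.inv_closed b(2))
    also have "\<dots> = \<one>\<^bsub>G2\<^esub>"
      using bc by (intro G2.r_inv F2_G2.hom_closed)
    finally have "a \<otimes>\<^bsub>F2\<^esub> inv\<^bsub>F2\<^esub> b \<in> kernel F2 G2 ?pi"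
      using ac bc unfolding kernel_def by blast
    then have "a \<otimes>\<^bsub>F2\<^esub> inv\<^bsub>F2\<^esub> b \<otimes>\<^bsub>F2\<^esub> b \<in> kernel F2 (impose Q R) g"
      using pi_ker F_g b(1) by (intro Kg.m_closed subsetD[OF F_g b(1)] subsetD[OF pi_ker])
    then show "a \<in> kernel F2 (impose Q R) g"
      using ac bc by (simp add: F2.m_assoc)
  next
    \<comment> \<open>The image of the kernel of \<open>f\<close> in \<open>Q\<close> is normal
      because the projection is onto. It contains the relator, hence \<open>rel\<close> after
      undoing the conjugation, hence the normal closure of \<open>rel\<close>.\<close>
    fix a assume a: "a \<in> kernel F2 (impose Q R) g"
    let ?K = "(\<lambda>a. ?F #>\<^bsub>F2\<^esub> a) ` kernel F2 (G2 Mod ?G) f"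
    interpret K: normal ?K Q
      by (rule Kf.surj_hom_normal_subgroup[OF p.group_hom_axioms p_surj])
    have "G2_word F2 x_F2 y_F2 \<in> kernel F2 (G2 Mod ?G) f"
      unfolding f_ker using G2_word_G2 GN.one_closed
      by (simp add: F2_G2.hom_G2_word x_G2_def y_G2_def)
    then have "inv\<^bsub>Q\<^esub> x \<otimes>\<^bsub>Q\<^esub> (x \<otimes>\<^bsub>Q\<^esub> rel \<otimes>\<^bsub>Q\<^esub> inv\<^bsub>Q\<^esub> x) \<otimes>\<^bsub>Q\<^esub> x \<in> ?K"
      using xy unfolding p_word[symmetric] by (intro K.inv_op_closed1) auto
    then have "rel \<in> ?K"
      using xy rel by (simp add: p.H.m_assoc p.H.inv_cancel_left)
    then have "normal_closure Q {rel} \<subseteq> ?K"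
      by (intro normal_closure_minimal K.normal_axioms) simp
    then obtain b where b: "b \<in> kernel F2 (G2 Mod ?G) f" "?F #>\<^bsub>F2\<^esub> a = ?F #>\<^bsub>F2\<^esub> b"
      using a unfolding g_ker by blast
    have c: "a \<in> carrier F2" "b \<in> carrier F2"
      using a b(1) unfolding g_ker f_ker by simp_all
    \<comment> \<open>Elements with equal image in \<open>Q\<close> differ by gamma_4 of
      \<open>F2\<close>, which \<open>f\<close> kills.\<close>
    have "a \<otimes>\<^bsub>F2\<^esub> inv\<^bsub>F2\<^esub> b \<in> ?F"
      by (rule iffD1[OF FN.Mod_eq_one_iff F2.coset_mult_inv2[OF b(2) c FN.subset]]) (simp add: c)
    then have "a \<otimes>\<^bsub>F2\<^esub> inv\<^bsub>F2\<^esub> b \<otimes>\<^bsub>F2\<^esub> b \<in> kernel F2 (G2 Mod ?G) f"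
      by (intro Kf.m_closed b(1) subsetD[OF F_f])
    then show "a \<in> kernel F2 (G2 Mod ?G) f"
      using c by (simp add: F2.m_assoc)
  qed
  then obtain h where "h \<in> iso (G2 Mod ?G) (impose Q R)" "\<And>a. a \<in> carrier F2 \<Longrightarrow> h (f a) = g a"
    using iso_of_epis_same_kernel[OF f.group_hom_axioms f_surj g.group_hom_axioms g_surj] by blast
  moreover have "f x_F2 = ?G #>\<^bsub>G2\<^esub> x_G2" "f y_F2 = ?G #>\<^bsub>G2\<^esub> y_G2"
      "g x_F2 = impose_class Q R x" "g y_F2 = impose_class Q R y"
    by (simp_all add: f_def g_def x_G2_def y_G2_def x_def y_def)
  ultimately show ?thesis
    by (metis F2_gens_closed)
qed

theorem proposition4p3:
  shows "lower_central_factor 2 G2 \<cong> integer_mod_group 4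
    \<and> (\<forall>k\<ge>2. finite (carrier (lower_central_factor k G2))
            \<and> group_exponent (lower_central_factor k G2) = 4)
    \<and> (let Q = F2 Mod lower_central 4 F2;
           x = lower_central 4 F2 #>\<^bsub>F2\<^esub> x_F2;
           y = lower_central 4 F2 #>\<^bsub>F2\<^esub> y_F2;
           R = class3_relation Q x y
       in \<exists>h \<in> iso (G2 Mod lower_central 4 G2) (impose Q R).
            h (lower_central 4 G2 #>\<^bsub>G2\<^esub> x_G2) = impose_class Q R x
          \<and> h (lower_central 4 G2 #>\<^bsub>G2\<^esub> y_G2) = impose_class Q R y)"
proof -
  have "group_exponent (lower_central_factor k G2) = 4" if "k \<ge> 2" for k
  proof -
    interpret Q: comm_group "lower_central_factor k G2"
      by (rule G2.comm_group_lower_central_factor)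
    obtain q where "q \<in> carrier (lower_central_factor k G2)" "Q.ord q = 4"
      using lower_central_factor_G2(3)[OF \<open>k \<ge> 2\<close>] by blast
    then show ?thesis
      using lower_central_factor_G2(2)[OF \<open>k \<ge> 2\<close>] by (intro Q.group_exponent_eqI) simp_all
  qed
  then show ?thesis
    unfolding Let_def
    using lower_central_factor_2_G2 lower_central_factor_G2(1) G2_Mod_lower_central_4 by blast
qed

end
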